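(* There exists a critical value $\gamma_c\in(1,\frac53)$ such that, for steady transonic shock solutions of the quasi-one-dimensional full Euler equations with adiabatic exponent $\gamma\in(1,3)$ in a divergent nozzle: (a) if $\gamma\in(\gamma_c,3)$, the shock boundary is dissipative for every steady transonic shock solution, i.e. $\tilde\theta_d<1$, where $$\tilde\theta_d:=\Big|\frac{\partial\mathscr{A}_3}{\partial x}\Big|\cdot\Big|\frac{\partial\mathcal{F}}{\partial x}\Big|^{-1}\cdot\Big(\Big|\frac{\partial\mathcal{F}}{\partial\bar\Upsilon_1}\Big|+\Big|\frac{\partial\mathcal{F}}{\partial\bar\Upsilon_3}\Big|\Big)+\Big|\frac{\partial\mathscr{A}_3}{\partial\bar\Upsilon_1}\Big|,$$ all derivatives being evaluated at the background state (the shock position $x=\tilde x$ with all perturbations equal to zero); (b) if $\gamma\in(1,\gamma_c]$, there is a constant $\tilde M_c=\tilde M_c(\gamma)<1$ such that the shock boundary is dissipative ($\tilde\theta_d<1$) whenever the background steady transonic shock solution satisfies $$\tilde M_c<M_r<1,$$ where $M_r=u_r/c_r$ is the Mach number of the background state immediately downstream of the shock.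
   Context: **Background.** Let $a$ be a smooth positive area function with $0<m_a\le a'(x)/a(x)\le M_a<\infty$ on $[0,L]$. A steady transonic shock solution consists of a point $\tilde x\in(0,L)$ and positive states $(\tilde\rho_\pm,\tilde u_\pm,\tilde p_\pm)(x)$, each solving the steady system $\frac{d}{dx}(\tilde\rho\tilde u)=-\frac{a'}{a}\tilde\rho\tilde u$, $\frac{d}{dx}(\tilde\rho\tilde u^2+\tilde p)=-\frac{a'}{a}\tilde\rho\tilde u^2$, $\frac{d}{dx}(\frac12\tilde\rho\tilde u^3+\frac{\gamma}{\gamma-1}\tilde p\tilde u)=-\frac{a'}{a}(\frac12\tilde\rho\tilde u^3+\frac{\gamma}{\gamma-1}\tilde p\tilde u)$, the $-$ branch on $[0,\tilde x]$ and the $+$ branch on $[\tilde x,L]$, both extended as solutions to a neighborhood of $\tilde x$; with $\tilde c=\sqrt{\gamma\tilde p/\tilde\rho}$, the $-$ branch is supersonic ($\tilde u_->\tilde c_-$) and the $+$ branch subsonic ($\tilde u_+<\tilde c_+$); and at $\tilde x$ the zero-speed Rankine--Hugoniot conditions hold: $\rho u$, $\rho u^2+p$ and $\frac12\rho u^3+\frac{\gamma}{\gamma-1}pu$ take equal values on the two sides. Subscripts $l$, $r$ denote states immediately to the left and right of the shock; for the background, $u_r=\tilde u_+(\tilde x)$, $c_r=\tilde c_+(\tilde x)$, etc. **Variables.** For $x$ near $\tilde x$, a right state $(\rho_r,u_r,p_r)$ near the background is represented by $\bar\Upsilon=(\bar\Upsilon_1,\bar\Upsilon_2,\bar\Upsilon_3)$: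 $$\bar\Upsilon_1=2\sqrt{p_r}-\sqrt{\gamma\rho_r}(u_r-\tilde u_+(x))-2\sqrt{\tilde p_+(x)},\qquad \bar\Upsilon_3=2\sqrt{p_r}+\sqrt{\gamma\rho_r}(u_r-\tilde u_+(x))-2\sqrt{\tilde p_+(x)},$$ $$\bar\Upsilon_2=(\ln p_r-\gamma\ln\rho_r)-(\ln\tilde p_+(x)-\gamma\ln\tilde\rho_+(x)),$$ which is locally invertible, so $(\rho_r,u_r,p_r)$ is a function of $(x,\bar\Upsilon)$. A left state is written $(\rho_l,u_l,p_l)=(\tilde\rho_-(x)+\bar\rho_l,\tilde u_-(x)+\bar u_l,\tilde p_-(x)+\bar p_l)$. **Shock boundary functions.** Eliminating the shock speed from the Rankine--Hugoniot conditions gives $$\sqrt{p_r-p_l}\sqrt{\rho_r-\rho_l}+\sqrt{\rho_r\rho_l}(u_r-u_l)=0,\qquad \Big(\tfrac{\gamma-1}{2}\rho_r-\tfrac{\gamma+1}{2}\rho_l\Big)(p_r-p_l)+\gamma p_l(\rho_r-\rho_l)=0.$$ Regarded as equations in $(x,\bar\Upsilon,\bar\rho_l,\bar u_l,\bar p_l)$, these determine near the background, by the implicit function theorem, $\bar\Upsilon_2=\mathscr{A}_2(x,\bar\Upsilon_1,\bar\rho_l,\bar u_l,\bar p_l)$ and $\bar\Upsilon_3=\mathscr{A}_3(x,\bar\Upsilon_1,\bar\rho_l,\bar u_l,\bar p_l)$. The derivatives of $\mathscr{A}_3$ are taken at $(\tilde x,0,0,0,0)$. **Shock speed function.** $\mathcal{F}(x,\bar\Upsilon,\bar\rho_l,\bar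 u_l,\bar p_l):=u_l-\sqrt{\dfrac{\rho_r}{\rho_l}}\sqrt{\dfrac{p_r-p_l}{\rho_r-\rho_l}}$, with $x$, $\bar\Upsilon_1,\bar\Upsilon_2,\bar\Upsilon_3,\bar\rho_l,\bar u_l,\bar p_l$ treated as independent variables; its derivatives are taken at $x=\tilde x$, $\bar\Upsilon=0$, $\bar\rho_l=\bar u_l=\bar p_l=0$. *)

theory Defs
  imports "HOL-Analysis.Analysis"
begin

datatype gas_state = Gas (rho: real) (vel: real) (prs: real)

definition sound_speed :: "real \<Rightarrow> gas_state \<Rightarrow> real" where
  "sound_speed \<gamma> s = sqrt (\<gamma> * prs s / rho s)"

definition mach :: "real \<Rightarrow> gas_state \<Rightarrow> real" where
  "mach \<gamma> s = vel s / sound_speed \<gamma> s"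

definition positive_state :: "gas_state \<Rightarrow> bool" where
  "positive_state s \<longleftrightarrow> 0 < rho s \<and> 0 < vel s \<and> 0 < prs s"

definition mass_flux :: "gas_state \<Rightarrow> real" where
  "mass_flux s = rho s * vel s"

definition energy_flux :: "real \<Rightarrow> gas_state \<Rightarrow> real" where
  "energy_flux \<gamma> s = 1 / 2 * rho s * vel s ^ 3 + \<gamma> / (\<gamma> - 1) * prs s * vel s"

definition momentum_flux :: "gas_state \<Rightarrow> real" where
  "momentum_flux s = rho s * (vel s)\<^sup>2 + prs s"


section \<open>Nozzle and steady flow\<close>

text \<open>Derivative on the compact interval, one-sided at the two end points.\<close>

definition interval_deriv :: "real \<Rightarrow> (real \<Rightarrow> real) \<Rightarrow> real \<Rightarrow> real" where
  "interval_deriv L f x = vector_derivative f (at x within {0..L})"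

definition smooth_on_interval :: "real \<Rightarrow> (real \<Rightarrow> real) \<Rightarrow> bool" where
  "smooth_on_interval L f \<longleftrightarrow>
     (\<forall>k. \<forall>x\<in>{0..L}. ((interval_deriv L ^^ k) f) differentiable (at x within {0..L}))"

definition divergent_nozzle :: "real \<Rightarrow> (real \<Rightarrow> real) \<Rightarrow> bool" where
  "divergent_nozzle L a \<longleftrightarrow>
     0 < L \<and> smooth_on_interval L a \<and> (\<forall>x\<in>{0..L}. 0 < a x) \<and>
     (\<exists>m M. 0 < m \<and>
        (\<forall>x\<in>{0..L}. m \<le> interval_deriv L a x / a x \<and> interval_deriv L a x / a x \<le> M))"

text \<open>Classical solutions: without differentiability of the state itself, the balance laws would
  permit a branch to jump between the two roots of the flux relations.\<close>

definition steady_flow ::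
  "real \<Rightarrow> real \<Rightarrow> (real \<Rightarrow> real) \<Rightarrow> real set \<Rightarrow> (real \<Rightarrow> gas_state) \<Rightarrow> bool" where
  "steady_flow \<gamma> L a S U \<longleftrightarrow>
     (\<forall>x\<in>S. positive_state (U x)) \<and>
     (\<lambda>x. rho (U x)) differentiable_on S \<and>
     (\<lambda>x. vel (U x)) differentiable_on S \<and>
     (\<lambda>x. prs (U x)) differentiable_on S \<and>
     (\<forall>x\<in>S. let k = interval_deriv L a x / a x in
        ((\<lambda>y. mass_flux (U y)) has_real_derivative - k * mass_flux (U x)) (at x within S) \<and>
        ((\<lambda>y. momentum_flux (U y)) has_real_derivative
            - k * (rho (U x) * (vel (U x))\<^sup>2)) (at x within S) \<and>
        ((\<lambda>y. energy_flux \<gamma> (U y)) has_real_derivative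
            - k * energy_flux \<gamma> (U x)) (at x within S))"

definition steady_transonic_shock ::
  "real \<Rightarrow> real \<Rightarrow> (real \<Rightarrow> real) \<Rightarrow> real \<Rightarrow> (real \<Rightarrow> gas_state) \<Rightarrow> (real \<Rightarrow> gas_state) \<Rightarrow> bool" where
  "steady_transonic_shock \<gamma> L a xs Um Up \<longleftrightarrow>
     divergent_nozzle L a \<and> 0 < xs \<and> xs < L \<and>
     (\<exists>e>0. e \<le> xs \<and> e \<le> L - xs \<and>
        steady_flow \<gamma> L a {0..xs + e} Um \<and> steady_flow \<gamma> L a {xs - e..L} Up) \<and>
     (\<forall>x\<in>{0..xs}. sound_speed \<gamma> (Um x) < vel (Um x)) \<and>
     (\<forall>x\<in>{xs..L}. vel (Up x) < sound_speed \<gamma> (Up x)) \<and>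
     mass_flux (Um xs) = mass_flux (Up xs) \<and>
     momentum_flux (Um xs) = momentum_flux (Up xs) \<and>
     energy_flux \<gamma> (Um xs) = energy_flux \<gamma> (Up xs)"


section \<open>Perturbation variables\<close>

text \<open>In the next three definitions \<open>b\<close> is the background state at the point considered and \<open>s\<close> the
  perturbed state.\<close>

definition Ups1 :: "real \<Rightarrow> gas_state \<Rightarrow> gas_state \<Rightarrow> real" where
  "Ups1 \<gamma> b s = 2 * sqrt (prs s) - sqrt (\<gamma> * rho s) * (vel s - vel b) - 2 * sqrt (prs b)"

definition Ups2 :: "real \<Rightarrow> gas_state \<Rightarrow> gas_state \<Rightarrow> real" where
  "Ups2 \<gamma> b s = (ln (prs s) - \<gamma> * ln (rho s)) - (ln (prs b) - \<gamma> * ln (rho b))"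

definition Ups3 :: "real \<Rightarrow> gas_state \<Rightarrow> gas_state \<Rightarrow> real" where
  "Ups3 \<gamma> b s = 2 * sqrt (prs s) + sqrt (\<gamma> * rho s) * (vel s - vel b) - 2 * sqrt (prs b)"

text \<open>The inverse of \<open>s \<mapsto> (Ups1, Ups2, Ups3)\<close>. The map is injective on all states with positive
  density and pressure, so no localisation is needed; see \<open>right_state_eq\<close> below.\<close>

definition right_state :: "real \<Rightarrow> gas_state \<Rightarrow> real \<Rightarrow> real \<Rightarrow> real \<Rightarrow> gas_state" where
  "right_state \<gamma> b y1 y2 y3 =
     (THE s. 0 < rho s \<and> 0 < prs s \<and> Ups1 \<gamma> b s = y1 \<and> Ups2 \<gamma> b s = y2 \<and> Ups3 \<gamma> b s = y3)"

definition left_state :: "gas_state \<Rightarrow> real \<Rightarrow> real \<Rightarrow> real \<Rightarrow> gas_state" where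
  "left_state b r v q = Gas (rho b + r) (vel b + v) (prs b + q)"

lemma Ups_inverse_iff:
  fixes \<gamma> y1 y2 y3 :: real and b s :: gas_state
  assumes "0 < \<gamma>" "0 < rho b" "0 < prs b" "0 < sqrt (prs b) + (y1 + y3) / 4"
  defines "P \<equiv> (sqrt (prs b) + (y1 + y3) / 4)\<^sup>2"
  defines "R \<equiv> rho b * (P / prs b * exp (- y2)) powr (1 / \<gamma>)"
  shows "0 < rho s \<and> 0 < prs s \<and> Ups1 \<gamma> b s = y1 \<and> Ups2 \<gamma> b s = y2 \<and> Ups3 \<gamma> b s = y3 \<longleftrightarrow>
    s = Gas R (vel b + (y3 - y1) / (2 * sqrt (\<gamma> * R))) P" (is "?L \<longleftrightarrow> ?Q")
proof -
  have P: "0 < P" "sqrt P = sqrt (prs b) + (y1 + y3) / 4"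
    using assms(4) by (auto simp: P_def)
  have R: "0 < R" using assms(2,3) P(1) by (simp add: R_def)
  have lnR: "ln R = ln (rho b) + (ln P - ln (prs b) - y2) / \<gamma>"
    using assms(2,3) P(1) by (simp add: R_def ln_mult ln_div ln_powr)
  show ?thesis
  proof
    assume ?Q
    then have s: "rho s = R" "prs s = P" "vel s - vel b = (y3 - y1) / (2 * sqrt (\<gamma> * R))"
      by auto
    have "sqrt (\<gamma> * R) * (vel s - vel b) = (y3 - y1) / 2"
      using s(3) R assms(1) by (simp add: field_simps)
    then show ?L
      using P R assms(1) s(1,2) lnR
      by (auto simp: Ups1_def Ups2_def Ups3_def field_simps)
  next
    assume L: ?L
    then have pos: "0 < rho s" "0 < prs s" by auto
    from L have 1: "2 * sqrt (prs s) - sqrt (\<gamma> * rho s) * (vel s - vel b) - 2 * sqrt (prs b) = y1"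
      and 2: "(ln (prs s) - \<gamma> * ln (rho s)) - (ln (prs b) - \<gamma> * ln (rho b)) = y2"
      and 3: "2 * sqrt (prs s) + sqrt (\<gamma> * rho s) * (vel s - vel b) - 2 * sqrt (prs b) = y3"
      by (auto simp: Ups1_def Ups2_def Ups3_def)
    have "sqrt (prs s) = sqrt P" unfolding P(2) 1[symmetric] 3[symmetric] by (simp add: field_simps)
    then have p: "prs s = P" by simp
    have "ln (rho s) = ln R" unfolding lnR using 2 p assms(1) by (simp add: field_simps)
    then have r: "rho s = R" using pos R by simp
    have "sqrt (\<gamma> * R) * (vel s - vel b) = (y3 - y1) / 2"
      unfolding r[symmetric] 1[symmetric] 3[symmetric] by simp
    moreover have "sqrt (\<gamma> * R) > 0" using R assms(1) by simp
    ultimately have "vel s - vel b = (y3 - y1) / 2 / sqrt (\<gamma> * R)"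
      by (metis less_irrefl nonzero_mult_div_cancel_left)
    then have "vel s = vel b + (y3 - y1) / (2 * sqrt (\<gamma> * R))" by simp
    with p r show ?Q by (cases s) auto
  qed
qed

lemma right_state_eq:
  fixes \<gamma> y1 y2 y3 :: real and b :: gas_state
  assumes "0 < \<gamma>" "0 < rho b" "0 < prs b" "0 < sqrt (prs b) + (y1 + y3) / 4"
  defines "P \<equiv> (sqrt (prs b) + (y1 + y3) / 4)\<^sup>2"
  defines "R \<equiv> rho b * (P / prs b * exp (- y2)) powr (1 / \<gamma>)"
  shows "right_state \<gamma> b y1 y2 y3 = Gas R (vel b + (y3 - y1) / (2 * sqrt (\<gamma> * R))) P"
  unfolding right_state_def Ups_inverse_iff[OF assms(1-4)] P_def R_def by simp


section \<open>Shock boundary and shock speed functions\<close>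

definition shock_relations :: "real \<Rightarrow> gas_state \<Rightarrow> gas_state \<Rightarrow> bool" where
  "shock_relations \<gamma> l r \<longleftrightarrow>
     sqrt (prs r - prs l) * sqrt (rho r - rho l) + sqrt (rho r * rho l) * (vel r - vel l) = 0 \<and>
     ((\<gamma> - 1) / 2 * rho r - (\<gamma> + 1) / 2 * rho l) * (prs r - prs l)
       + \<gamma> * prs l * (rho r - rho l) = 0"

text \<open>\<open>A\<close> maps \<open>(x, y1, r, v, q)\<close>, with \<open>(r, v, q)\<close> the perturbation of the left state, to the pair of
  second and third components of the right perturbation: near the background, the solution set of
  the shock relations is the graph of \<open>A\<close>. Evaluating the equivalence at the background gives
  \<open>A (xs, 0, 0, 0, 0) = (0, 0)\<close>, and continuity there makes the germ of \<open>A\<close> unique.\<close>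

definition is_shock_boundary ::
  "real \<Rightarrow> real \<Rightarrow> (real \<Rightarrow> gas_state) \<Rightarrow> (real \<Rightarrow> gas_state) \<Rightarrow>
   (real \<times> real \<times> real \<times> real \<times> real \<Rightarrow> real \<times> real) \<Rightarrow> bool" where
  "is_shock_boundary \<gamma> xs Um Up A \<longleftrightarrow>
     isCont A (xs, 0, 0, 0, 0) \<and>
     (\<forall>\<^sub>F ((x, y1, r, v, q), (y2, y3)) in nhds ((xs, 0, 0, 0, 0), (0, 0)).
        shock_relations \<gamma> (left_state (Um x) r v q) (right_state \<gamma> (Up x) y1 y2 y3) \<longleftrightarrow>
        (y2, y3) = A (x, y1, r, v, q))"

text \<open>The choice fixes one representative of that germ; the partial derivatives at the background
  do not depend on it.\<close>

definition shock_boundary ::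
  "real \<Rightarrow> real \<Rightarrow> (real \<Rightarrow> gas_state) \<Rightarrow> (real \<Rightarrow> gas_state) \<Rightarrow>
   real \<times> real \<times> real \<times> real \<times> real \<Rightarrow> real \<times> real" where
  "shock_boundary \<gamma> xs Um Up = (SOME A. is_shock_boundary \<gamma> xs Um Up A)"

definition A3 ::
  "real \<Rightarrow> real \<Rightarrow> (real \<Rightarrow> gas_state) \<Rightarrow> (real \<Rightarrow> gas_state) \<Rightarrow>
   real \<Rightarrow> real \<Rightarrow> real \<Rightarrow> real \<Rightarrow> real \<Rightarrow> real" where
  "A3 \<gamma> xs Um Up x y1 r v q = snd (shock_boundary \<gamma> xs Um Up (x, y1, r, v, q))"

definition shock_speed ::
  "real \<Rightarrow> (real \<Rightarrow> gas_state) \<Rightarrow> (real \<Rightarrow> gas_state) \<Rightarrow>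
   real \<Rightarrow> real \<Rightarrow> real \<Rightarrow> real \<Rightarrow> real \<Rightarrow> real \<Rightarrow> real \<Rightarrow> real" where
  "shock_speed \<gamma> Um Up x y1 y2 y3 r v q =
     (let sl = left_state (Um x) r v q; sr = right_state \<gamma> (Up x) y1 y2 y3
      in vel sl - sqrt (rho sr / rho sl) * sqrt ((prs sr - prs sl) / (rho sr - rho sl)))"

definition theta_d ::
  "real \<Rightarrow> real \<Rightarrow> (real \<Rightarrow> gas_state) \<Rightarrow> (real \<Rightarrow> gas_state) \<Rightarrow> real" where
  "theta_d \<gamma> xs Um Up =
     \<bar>deriv (\<lambda>x. A3 \<gamma> xs Um Up x 0 0 0 0) xs\<bar>
     * inverse \<bar>deriv (\<lambda>x. shock_speed \<gamma> Um Up x 0 0 0 0 0 0) xs\<bar>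
     * (\<bar>deriv (\<lambda>y. shock_speed \<gamma> Um Up xs y 0 0 0 0 0) 0\<bar>
        + \<bar>deriv (\<lambda>y. shock_speed \<gamma> Um Up xs 0 0 y 0 0 0) 0\<bar>)
     + \<bar>deriv (\<lambda>y. A3 \<gamma> xs Um Up xs y 0 0 0) 0\<bar>"

text \<open>The first conjunct makes explicit what the quotient in \<open>theta_d\<close> presupposes; it is needed
  since \<open>inverse 0 = 0\<close>.\<close>

definition dissipative_shock_boundary ::
  "real \<Rightarrow> real \<Rightarrow> (real \<Rightarrow> gas_state) \<Rightarrow> (real \<Rightarrow> gas_state) \<Rightarrow> bool" where
  "dissipative_shock_boundary \<gamma> xs Um Up \<longleftrightarrow>
     deriv (\<lambda>x. shock_speed \<gamma> Um Up x 0 0 0 0 0 0) xs \<noteq> 0 \<and> theta_d \<gamma> xs Um Up < 1"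

end

theory Submission
  imports Defs
begin

text \<open>At the shock everything can be written in terms of the mass flux \<open>m\<close>, the two velocities
  \<open>w > u\<close> and \<open>\<gamma>\<close>. Put \<open>B = (\<gamma> + 1) w - (\<gamma> - 1) u\<close>, so that the downstream Mach number
  satisfies \<open>M\<^sup>2 = 2 u / B\<close>, and let \<open>\<sigma> = ((3 - \<gamma>) w + (\<gamma> + 1) u) / (4 w)\<close>. Reducing the shock
  relations to one scalar equation and differentiating it implicitly gives
  \<open>\<theta> = (X + |M - \<sigma>|) / (M + \<sigma>)\<close> with
  \<open>X = (\<gamma> + 1) (w - u) |(3 - \<gamma>) w - (\<gamma> - 1) u| / (2 w B)\<close>. Hence \<open>\<theta> < 1\<close> means \<open>X < 2 M\<close> and
  \<open>X < 2 \<sigma>\<close>. The second inequality always holds for \<open>\<gamma> < 3\<close>, and \<open>X \<le> 1 - M\<^sup>2\<close> reduces the first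
  to \<open>M\<^sup>2 + 2 M > 1\<close>. Positivity of the upstream pressure gives \<open>M\<^sup>2 > (\<gamma> - 1) / (2 \<gamma>)\<close>, which is
  enough when \<open>\<gamma> > 8 / 5\<close>; for smaller \<open>\<gamma>\<close> it suffices that \<open>M > 1 / 2\<close>.\<close>

section \<open>Scalar implicit functions\<close>

text \<open>Strict monotonicity in \<open>y\<close> makes roots unique and the intermediate value
  theorem produces them, so continuity in the parameter is enough. The conclusion is an equivalence
  on a full neighbourhood, as \<open>is_shock_boundary\<close> demands.\<close>

lemma implicit_function_scalar:
  fixes F F' :: "'a::metric_space \<Rightarrow> real \<Rightarrow> real"
  assumes der: "\<forall>\<^sub>F a in nhds a0. \<forall>y. (F a has_real_derivative F' a y) (at y)"
    and cont: "\<And>y. isCont (\<lambda>a. F a y) a0"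
    and cont': "isCont (\<lambda>(a, y). F' a y) (a0, y0)"
    and pos: "0 < F' a0 y0" and zero: "F a0 y0 = 0"
  obtains g where "g a0 = y0" "isCont g a0"
    "\<forall>\<^sub>F (a, y) in nhds (a0, y0). F a y = 0 \<longleftrightarrow> y = g a"
proof -
  have "\<forall>\<^sub>F z in nhds (a0, y0). 0 < (\<lambda>(a, y). F' a y) z"
    using cont' pos unfolding isCont_def tendsto_at_iff_tendsto_nhds
    by (intro order_tendstoD(1)) auto
  moreover have "\<forall>\<^sub>F z in nhds (a0, y0). \<forall>y. (F (fst z) has_real_derivative F' (fst z) y) (at y)"
    by (rule eventually_compose_filterlim[OF der]) (auto intro!: tendsto_eq_intros filterlim_ident)
  ultimately have "\<forall>\<^sub>F z in nhds (a0, y0). 0 < F' (fst z) (snd z) \<and>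
      (\<forall>y. (F (fst z) has_real_derivative F' (fst z) y) (at y))"
    by eventually_elim auto
  then obtain d where d: "d > 0"
    and d': "\<And>z. dist z (a0, y0) < d \<Longrightarrow> 0 < F' (fst z) (snd z) \<and>
      (\<forall>y. (F (fst z) has_real_derivative F' (fst z) y) (at y))"
    unfolding eventually_nhds_metric by blast
  \<comment> \<open>Half of \<open>d\<close>, so that the box of half-width \<open>r\<close> lies in
    the product-metric ball of radius \<open>d\<close>.\<close>
  define r where "r = d / 2"
  have r: "r > 0" using d by (simp add: r_def)
  have D: "0 < F' a y \<and> (\<forall>t. (F a has_real_derivative F' a t) (at t))"
    if "dist a a0 < r" "\<bar>y - y0\<bar> < r" for a y
  proof -
    have "dist (a, y) (a0, y0) \<le> dist a a0 + dist y y0"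
      by (simp add: dist_Pair_Pair sqrt_sum_squares_le_sum)
    also have "\<dots> < d" using that by (simp add: r_def dist_real_def)
    finally show ?thesis using d'[of "(a, y)"] by simp
  qed
  have mono: "F a y < F a z"
    if "dist a a0 < r" "\<bar>y - y0\<bar> < r" "\<bar>z - y0\<bar> < r" "y < z" for a y z
  proof (rule DERIV_pos_imp_increasing[OF that(4)])
    fix x assume "y \<le> x" "x \<le> z"
    then have "\<bar>x - y0\<bar> < r" using that(2,3) by auto
    then show "\<exists>d. (F a has_real_derivative d) (at x) \<and> 0 < d" using D[OF that(1)] by blast
  qed
  have lim: "((\<lambda>a. F a y) \<longlongrightarrow> F a0 y) (nhds a0)" for y
    using cont[of y] tendsto_at_iff_tendsto_nhds[of "\<lambda>a. F a y" a0] by (simp add: isCont_def)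
  \<comment> \<open>Stated for all small \<open>e\<close>: the case \<open>e = r\<close> gives
    existence of the root, arbitrary \<open>e\<close> gives continuity of \<open>g\<close>.\<close>
  have root: "\<forall>\<^sub>F a in nhds a0. \<exists>y. \<bar>y - y0\<bar> < e \<and> F a y = 0" if e: "0 < e" "e \<le> r" for e
  proof -
    define h where "h = e / 2"
    have h: "0 < h" "h < e" "h < r" using e by (auto simp: h_def)
    have "F a0 (y0 - h) < 0" "0 < F a0 (y0 + h)"
      using mono[of a0 "y0 - h" y0] mono[of a0 y0 "y0 + h"] h r zero by auto
    then have "\<forall>\<^sub>F a in nhds a0. F a (y0 - h) < 0" "\<forall>\<^sub>F a in nhds a0. 0 < F a (y0 + h)"
      using order_tendstoD[OF lim] by auto
    moreover have "\<forall>\<^sub>F a in nhds a0. dist a a0 < r"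
      using r by (auto simp: eventually_nhds_metric)
    ultimately show ?thesis
    proof eventually_elim
      case (elim a)
      have "continuous_on {y0 - h..y0 + h} (F a)"
        using D[OF elim(3), of y0] r by (intro DERIV_continuous_on) (auto intro: has_field_derivative_at_within)
      then obtain y where "y0 - h \<le> y" "y \<le> y0 + h" "F a y = 0"
        using IVT'[of "F a" "y0 - h" 0 "y0 + h"] elim h by auto
      then show ?case using h by (intro exI[of _ y]) auto
    qed
  qed
  have uniq: "y = z" if "dist a a0 < r" "\<bar>y - y0\<bar> < r" "\<bar>z - y0\<bar> < r" "F a y = 0" "F a z = 0" for a y z
    using mono[of a y z] mono[of a z y] that by (cases y z rule: linorder_cases) auto
  define g where "g a = (SOME y. \<bar>y - y0\<bar> < r \<and> F a y = 0)" for a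
  have ev: "\<forall>\<^sub>F a in nhds a0. dist a a0 < r \<and> \<bar>g a - y0\<bar> < r \<and> F a (g a) = 0"
  proof -
    have "\<forall>\<^sub>F a in nhds a0. dist a a0 < r" using r by (auto simp: eventually_nhds_metric)
    with root[OF r order_refl] show ?thesis
    proof eventually_elim
      case (elim a)
      then show ?case using someI_ex[OF elim(1)] by (simp add: g_def)
    qed
  qed
  have g0: "g a0 = y0"
    using eventually_nhds_x_imp_x[OF ev] uniq[of a0 "g a0" y0] zero r by auto
  have "(g \<longlongrightarrow> y0) (nhds a0)"
  proof (rule tendstoI)
    fix e :: real assume "0 < e"
    then have "\<forall>\<^sub>F a in nhds a0. \<exists>y. \<bar>y - y0\<bar> < min e r \<and> F a y = 0" using r by (intro root) auto
    with ev show "\<forall>\<^sub>F a in nhds a0. dist (g a) y0 < e"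
    proof eventually_elim
      case (elim a)
      then show ?case using uniq[of a "g a"] by (auto simp: dist_real_def)
    qed
  qed
  then have "isCont g a0" using tendsto_at_iff_tendsto_nhds[of g a0] by (simp add: isCont_def g0)
  moreover have "\<forall>\<^sub>F (a, y) in nhds (a0, y0). F a y = 0 \<longleftrightarrow> y = g a"
  proof -
    have "\<forall>\<^sub>F y in nhds y0. \<bar>y - y0\<bar> < r"
      using r by (auto simp: eventually_nhds_metric dist_real_def)
    then have "\<forall>\<^sub>F z in nhds (a0, y0). (dist (fst z) a0 < r \<and> \<bar>g (fst z) - y0\<bar> < r \<and>
        F (fst z) (g (fst z)) = 0) \<and> \<bar>snd z - y0\<bar> < r"
      using ev unfolding nhds_prod by (intro eventually_prodI)
    then show ?thesis
    proof eventually_elim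
      case (elim z)
      then show ?case using uniq[of "fst z" "snd z" "g (fst z)"] by (auto simp: case_prod_unfold)
    qed
  qed
  ultimately show ?thesis using g0 that by blast
qed

text \<open>By the mean value theorem in \<open>y\<close>, \<open>0 = F (c t) (g t) = F (c t) y0 +
  (g t - y0) * F' (c t) (\<xi> t)\<close>; dividing by \<open>t - t0\<close> gives the difference
  quotient of \<open>g\<close>. In the parameter, \<open>F\<close> is differentiated only along
  \<open>c\<close>, with \<open>y\<close> frozen at \<open>y0\<close>.\<close>

lemma implicit_function_scalar_deriv:
  fixes F F' :: "'a::metric_space \<Rightarrow> real \<Rightarrow> real" and c :: "real \<Rightarrow> 'a" and g :: "real \<Rightarrow> real"
  assumes der: "\<forall>\<^sub>F a in nhds (c t0). \<forall>y. (F a has_real_derivative F' a y) (at y)"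
    and cont': "isCont (\<lambda>(a, y). F' a y) (c t0, y0)"
    and nz: "F' (c t0) y0 \<noteq> 0" and zero: "F (c t0) y0 = 0"
    and c: "isCont c t0" and g: "isCont g t0" "g t0 = y0"
    and root: "\<forall>\<^sub>F t in nhds t0. F (c t) (g t) = 0"
    and dt: "((\<lambda>t. F (c t) y0) has_real_derivative d) (at t0)"
  shows "(g has_real_derivative - d / F' (c t0) y0) (at t0)"
proof -
  have clim: "(c \<longlongrightarrow> c t0) (at t0)" and glim: "(g \<longlongrightarrow> y0) (at t0)"
    using c g by (auto simp: isCont_def)
  \<comment> \<open>The derivative is available only for \<open>t\<close> near \<open>t0\<close>.
    Keeping it as a premise lets \<open>\<xi>\<close> be chosen as a total function, with witness
    \<open>y0\<close> where the premise fails.\<close>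
  have "\<exists>\<xi>. \<bar>\<xi> - y0\<bar> \<le> \<bar>g t - y0\<bar> \<and>
      ((\<forall>y. (F (c t) has_real_derivative F' (c t) y) (at y)) \<longrightarrow>
        F (c t) (g t) - F (c t) y0 = (g t - y0) * F' (c t) \<xi>)" for t
  proof (cases "\<forall>y. (F (c t) has_real_derivative F' (c t) y) (at y)")
    case True
    show ?thesis
    proof (cases "g t" y0 rule: linorder_cases)
      case less
      then obtain z where "g t < z" "z < y0"
        "F (c t) y0 - F (c t) (g t) = (y0 - g t) * F' (c t) z"
        using MVT2[OF less] True by blast
      then show ?thesis by (intro exI[of _ z]) (auto simp: algebra_simps)
    next
      case greater
      then obtain z where "y0 < z" "z < g t"
        "F (c t) (g t) - F (c t) y0 = (g t - y0) * F' (c t) z"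
        using MVT2[OF greater] True by blast
      then show ?thesis by (intro exI[of _ z]) auto
    qed auto
  qed (auto intro: exI[of _ y0])
  then obtain \<xi> where \<xi>: "\<And>t. \<bar>\<xi> t - y0\<bar> \<le> \<bar>g t - y0\<bar>"
    "\<And>t. \<forall>y. (F (c t) has_real_derivative F' (c t) y) (at y) \<Longrightarrow>
        F (c t) (g t) - F (c t) y0 = (g t - y0) * F' (c t) (\<xi> t)"
    by metis
  have "((\<lambda>t. \<xi> t - y0) \<longlongrightarrow> 0) (at t0)"
    by (rule Lim_null_comparison[of _ "\<lambda>t. \<bar>g t - y0\<bar>"])
      (use \<xi>(1) glim in \<open>auto intro!: tendsto_eq_intros\<close>)
  then have "(\<xi> \<longlongrightarrow> y0) (at t0)" by (simp add: LIM_zero_iff)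
  then have "((\<lambda>t. (\<lambda>(a, y). F' a y) (c t, \<xi> t)) \<longlongrightarrow> (\<lambda>(a, y). F' a y) (c t0, y0)) (at t0)"
    using clim by (intro isCont_tendsto_compose[OF cont'] tendsto_Pair)
  then have F'lim: "((\<lambda>t. F' (c t) (\<xi> t)) \<longlongrightarrow> F' (c t0) y0) (at t0)" by simp
  have "((\<lambda>t. - ((F (c t) y0 - F (c t0) y0) / (t - t0)) / F' (c t) (\<xi> t)) \<longlongrightarrow>
      - d / F' (c t0) y0) (at t0)"
    using dt nz F'lim by (intro tendsto_intros) (auto simp: has_field_derivative_iff)
  moreover have "\<forall>\<^sub>F t in at t0. - ((F (c t) y0 - F (c t0) y0) / (t - t0)) / F' (c t) (\<xi> t) =
      (g t - g t0) / (t - t0)"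
  proof -
    have "\<forall>\<^sub>F t in at t0. \<forall>y. (F (c t) has_real_derivative F' (c t) y) (at y)"
      using clim der by (rule eventually_compose_filterlim[rotated])
    moreover have "\<forall>\<^sub>F t in at t0. F (c t) (g t) = 0"
      using root by (simp add: eventually_nhds_conv_at)
    moreover have "\<forall>\<^sub>F t in at t0. F' (c t) (\<xi> t) \<noteq> 0"
      using F'lim nz by (rule tendsto_imp_eventually_ne)
    ultimately show ?thesis
    proof eventually_elim
      case (elim t)
      then have "F (c t) y0 = - ((g t - g t0) * F' (c t) (\<xi> t))"
        using \<xi>(2)[OF elim(1)] g(2) by simp
      then show ?case using elim zero by simp
    qed
  qed
  ultimately show ?thesis
    unfolding has_field_derivative_iff by (rule Lim_transform_eventually)
qed

section \<open>Steady flow and Rankine--Hugoniot conditions\<close>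

text \<open>The three balance laws form a linear system for the derivatives of density, velocity and
  pressure, which is solvable away from sonic states. At interior points the derivatives within
  \<open>S\<close> are two-sided.\<close>

lemma steady_flow_derivs:
  assumes flow: "steady_flow \<gamma> L a S U" and x: "x \<in> interior S" and g: "1 < \<gamma>"
  defines "k \<equiv> interval_deriv L a x / a x" and "r \<equiv> rho (U x)" and "u \<equiv> vel (U x)" and "p \<equiv> prs (U x)"
  assumes sonic: "\<gamma> * p \<noteq> r * u\<^sup>2"
  shows "((\<lambda>x. rho (U x)) has_real_derivative k * r\<^sup>2 * u\<^sup>2 / (\<gamma> * p - r * u\<^sup>2)) (at x)"
    and "((\<lambda>x. vel (U x)) has_real_derivative - k * \<gamma> * p * u / (\<gamma> * p - r * u\<^sup>2)) (at x)"
    and "((\<lambda>x. prs (U x)) has_real_derivative k * \<gamma> * p * r * u\<^sup>2 / (\<gamma> * p - r * u\<^sup>2)) (at x)"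
proof -
  have xS: "x \<in> S" and at: "at x within S = at x"
    using x interior_subset at_within_interior by blast+
  have "positive_state (U x)" using flow xS by (auto simp: steady_flow_def)
  then have pos: "0 < r" "0 < u" "0 < p" by (auto simp: positive_state_def r_def u_def p_def)
  have "(\<lambda>x. rho (U x)) differentiable at x" "(\<lambda>x. vel (U x)) differentiable at x"
    "(\<lambda>x. prs (U x)) differentiable at x"
    using flow xS at by (auto simp: steady_flow_def differentiable_on_def)
  then obtain r' u' p' where
    D: "((\<lambda>x. rho (U x)) has_real_derivative r') (at x)"
    "((\<lambda>x. vel (U x)) has_real_derivative u') (at x)"
    "((\<lambda>x. prs (U x)) has_real_derivative p') (at x)"
    by (auto simp: real_differentiable_def)
  have law: "((\<lambda>y. mass_flux (U y)) has_real_derivative - k * (r * u)) (at x)"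
    "((\<lambda>y. momentum_flux (U y)) has_real_derivative - k * (r * u\<^sup>2)) (at x)"
    "((\<lambda>y. energy_flux \<gamma> (U y)) has_real_derivative - k * energy_flux \<gamma> (U x)) (at x)"
    using flow xS at by (auto simp: steady_flow_def Let_def mass_flux_def k_def r_def u_def)
  have 1: "r' * u + r * u' = - k * (r * u)"
    by (rule DERIV_unique[OF _ law(1)])
      (auto simp: mass_flux_def r_def u_def intro!: derivative_eq_intros D)
  have "r' * u\<^sup>2 + 2 * r * u * u' + p' = - k * (r * u\<^sup>2)"
    by (rule DERIV_unique[OF _ law(2)])
      (auto simp: momentum_flux_def r_def u_def algebra_simps power2_eq_square intro!: derivative_eq_intros D)
  \<comment> \<open>The mass law times \<open>u\<close>, subtracted from the momentum law, leaves
    \<open>p' = - r * u * u'\<close>.\<close>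
  moreover have "r' * u\<^sup>2 + r * u * u' = - k * (r * u\<^sup>2)"
    using arg_cong[OF 1, of "\<lambda>z. z * u"] by (simp add: algebra_simps power2_eq_square)
  ultimately have 2: "p' = - r * u * u'" by simp
  have "1 / 2 * (r' * u ^ 3 + 3 * r * u\<^sup>2 * u') + \<gamma> / (\<gamma> - 1) * (p' * u + p * u') =
      - k * energy_flux \<gamma> (U x)"
  proof (rule DERIV_unique[OF _ law(3)])
    define K where "K = \<gamma> / (\<gamma> - 1)"
    show "((\<lambda>y. energy_flux \<gamma> (U y)) has_real_derivative
        1 / 2 * (r' * u ^ 3 + 3 * r * u\<^sup>2 * u') + \<gamma> / (\<gamma> - 1) * (p' * u + p * u')) (at x)"
      unfolding energy_flux_def K_def[symmetric] r_def u_def p_def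
      by (auto simp: algebra_simps intro!: derivative_eq_intros D)
  qed
  also have "\<dots> = - k * (1 / 2 * r * u ^ 3) - k * (\<gamma> / (\<gamma> - 1) * p * u)"
    by (simp add: energy_flux_def r_def u_def p_def algebra_simps)
  finally have 3: "1 / 2 * (r' * u ^ 3 + 3 * r * u\<^sup>2 * u') + \<gamma> / (\<gamma> - 1) * (p' * u + p * u') =
     - k * (1 / 2 * r * u ^ 3) - k * (\<gamma> / (\<gamma> - 1) * p * u)" .
  \<comment> \<open>The mass law times \<open>u\<^sup>2 / 2\<close> removes the source of kinetic
    energy from the energy law.\<close>
  have "1 / 2 * (r' * u ^ 3 + r * u\<^sup>2 * u') = - k * (1 / 2 * r * u ^ 3)"
    using arg_cong[OF 1, of "\<lambda>z. z * u\<^sup>2 / 2"] by (simp add: algebra_simps power2_eq_square power3_eq_cube)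
  with 3 have "r * u\<^sup>2 * u' + \<gamma> / (\<gamma> - 1) * (p' * u + p * u') = - k * (\<gamma> / (\<gamma> - 1) * p * u)"
    by (simp add: algebra_simps)
  then have "(\<gamma> - 1) * (r * u\<^sup>2 * u') = - \<gamma> * (p' * u + p * u' + k * p * u)"
    using g by (simp add: divide_simps) (simp add: algebra_simps)
  then have "u' * (\<gamma> * p - r * u\<^sup>2) = - k * \<gamma> * p * u"
    unfolding 2 by (simp add: algebra_simps power2_eq_square)
  then have u': "u' = - k * \<gamma> * p * u / (\<gamma> * p - r * u\<^sup>2)"
    using sonic by (simp add: field_simps)
  have p': "p' = k * \<gamma> * p * r * u\<^sup>2 / (\<gamma> * p - r * u\<^sup>2)"
    unfolding 2 u' by (simp add: power2_eq_square)
  have "r' = - (k * r) - r * u' / u" using 1 pos by (simp add: field_simps)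
  also have "\<dots> = k * r\<^sup>2 * u\<^sup>2 / (\<gamma> * p - r * u\<^sup>2)"
    unfolding u' using pos sonic by (simp add: field_simps power2_eq_square)
  finally show "((\<lambda>x. rho (U x)) has_real_derivative k * r\<^sup>2 * u\<^sup>2 / (\<gamma> * p - r * u\<^sup>2)) (at x)"
    using D(1) by simp
  show "((\<lambda>x. vel (U x)) has_real_derivative - k * \<gamma> * p * u / (\<gamma> * p - r * u\<^sup>2)) (at x)"
    using D(2) u' by simp
  show "((\<lambda>x. prs (U x)) has_real_derivative k * \<gamma> * p * r * u\<^sup>2 / (\<gamma> * p - r * u\<^sup>2)) (at x)"
    using D(3) p' by simp
qed

lemma sound_speed_less_iff:
  assumes "positive_state s" "0 < \<gamma>"
  shows "sound_speed \<gamma> s < vel s \<longleftrightarrow> \<gamma> * prs s < rho s * (vel s)\<^sup>2"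
    and "vel s < sound_speed \<gamma> s \<longleftrightarrow> rho s * (vel s)\<^sup>2 < \<gamma> * prs s"
proof -
  have v: "\<bar>vel s\<bar> = vel s" using assms by (simp add: positive_state_def)
  show "sound_speed \<gamma> s < vel s \<longleftrightarrow> \<gamma> * prs s < rho s * (vel s)\<^sup>2"
    "vel s < sound_speed \<gamma> s \<longleftrightarrow> rho s * (vel s)\<^sup>2 < \<gamma> * prs s"
    using assms real_sqrt_less_iff[of "\<gamma> * prs s / rho s" "(vel s)\<^sup>2"]
      real_sqrt_less_iff[of "(vel s)\<^sup>2" "\<gamma> * prs s / rho s"]
    unfolding sound_speed_def
    by (auto simp: v positive_state_def divide_less_eq less_divide_eq mult_ac simp del: real_sqrt_less_iff)
qed

text \<open>Eliminating one pressure by momentum conservation makes the energy balance divisible by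
  the velocity jump. The hypotheses are symmetric in the two sides, so exchanging them gives the
  other pressure.\<close>

lemma rankine_hugoniot_prs:
  assumes "positive_state l" "positive_state r" "1 < \<gamma>" "vel l \<noteq> vel r"
    "mass_flux l = mass_flux r" "momentum_flux l = momentum_flux r"
    "energy_flux \<gamma> l = energy_flux \<gamma> r"
  shows "2 * \<gamma> * prs r = mass_flux r * ((\<gamma> + 1) * vel l - (\<gamma> - 1) * vel r)"
proof -
  define m w u p q where "m = mass_flux r" and "w = vel l" and "u = vel r" and "p = prs r" and "q = prs l"
  have pos: "w > 0" "u > 0" using assms by (auto simp: positive_state_def w_def u_def)
  have rho: "rho l * w = m" "rho r * u = m"
    using assms by (auto simp: mass_flux_def m_def w_def u_def)
  have mom: "m * w + q = m * u + p"
  proof -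
    have "m * w = rho l * w\<^sup>2" "m * u = rho r * u\<^sup>2"
      using rho by (auto simp: power2_eq_square)
    then show ?thesis using assms(6)
      by (simp add: momentum_flux_def w_def u_def p_def q_def)
  qed
  have en: "m * w\<^sup>2 / 2 + \<gamma> / (\<gamma> - 1) * q * w = m * u\<^sup>2 / 2 + \<gamma> / (\<gamma> - 1) * p * u"
  proof -
    have "m * w\<^sup>2 = rho l * w ^ 3" "m * u\<^sup>2 = rho r * u ^ 3"
      using rho by (auto simp: power2_eq_square power3_eq_cube)
    then show ?thesis using assms(7)
      by (simp add: energy_flux_def w_def u_def p_def q_def)
  qed
  then have "m * (w\<^sup>2 - u\<^sup>2) / 2 = \<gamma> / (\<gamma> - 1) * (p * u - q * w)"
    by (simp add: algebra_simps diff_divide_distrib)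
  then have "(\<gamma> - 1) * m * w\<^sup>2 + 2 * \<gamma> * q * w = (\<gamma> - 1) * m * u\<^sup>2 + 2 * \<gamma> * p * u"
    using assms(3) by (simp add: divide_simps) (simp add: algebra_simps)
  moreover have q: "q = p - m * (w - u)" using mom by (simp add: algebra_simps)
  ultimately have "(w - u) * (2 * \<gamma> * p - m * ((\<gamma> + 1) * w - (\<gamma> - 1) * u)) = 0"
    unfolding q by (simp add: algebra_simps power2_eq_square)
  then show ?thesis using assms(4) by (simp add: m_def w_def u_def p_def)
qed

section \<open>The reduced shock relation\<close>

definition shock_den :: "real \<Rightarrow> real \<Rightarrow> real \<Rightarrow> real" where
  "shock_den \<gamma> p q = (\<gamma> + 1) * p + (\<gamma> - 1) * q"

definition hugoniot_density :: "real \<Rightarrow> real \<Rightarrow> real \<Rightarrow> real \<Rightarrow> real" where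
  "hugoniot_density \<gamma> rl pl p = rl * shock_den \<gamma> p pl / shock_den \<gamma> pl p"

text \<open>Equal to \<open>1 / sqrt (\<gamma> * R)\<close> for the Hugoniot density \<open>R\<close>.\<close>

definition hugoniot_scale :: "real \<Rightarrow> real \<Rightarrow> real \<Rightarrow> real \<Rightarrow> real" where
  "hugoniot_scale \<gamma> rl pl p = sqrt (shock_den \<gamma> pl p / (\<gamma> * rl * shock_den \<gamma> p pl))"

text \<open>The drop \<open>vel l - vel r\<close> that the first shock relation prescribes for the
  downstream pressure \<open>p\<close>, once the density is the Hugoniot density.\<close>

definition velocity_drop :: "real \<Rightarrow> real \<Rightarrow> real \<Rightarrow> real \<Rightarrow> real" where
  "velocity_drop \<gamma> rl pl p = (p - pl) * sqrt (2 / (rl * shock_den \<gamma> p pl))"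

text \<open>With the downstream density eliminated through the Hugoniot relation and the downstream pressure
  \<open>P\<close> expressed by the first and third perturbation variables, the remaining shock relation is one
  scalar equation for \<open>y3\<close>; \<open>v\<close> and \<open>s\<close> are the background velocity and root of the pressure.\<close>

definition defect :: "real \<Rightarrow> real \<Rightarrow> real \<Rightarrow> gas_state \<Rightarrow> real \<Rightarrow> real \<Rightarrow> real" where
  "defect \<gamma> v s l y1 y3 = (let P = (s + (y1 + y3) / 4)\<^sup>2 in
     v - vel l + (y3 - y1) / 2 * hugoniot_scale \<gamma> (rho l) (prs l) P
       + velocity_drop \<gamma> (rho l) (prs l) P)"

text \<open>Primes denote derivatives in the last argument. The closed forms let joint continuity
  follow from limit rules, as in \<open>tendsto_defect'\<close>.\<close>

definition velocity_drop' :: "real \<Rightarrow> real \<Rightarrow> real \<Rightarrow> real \<Rightarrow> real" where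
  "velocity_drop' \<gamma> rl pl p = sqrt (2 / (rl * shock_den \<gamma> p pl))
     * (1 - (\<gamma> + 1) * (p - pl) / (2 * shock_den \<gamma> p pl))"

definition hugoniot_scale' :: "real \<Rightarrow> real \<Rightarrow> real \<Rightarrow> real \<Rightarrow> real" where
  "hugoniot_scale' \<gamma> rl pl p =
     - 2 * pl / (rl * (shock_den \<gamma> p pl)\<^sup>2 * hugoniot_scale \<gamma> rl pl p)"

definition defect' :: "real \<Rightarrow> real \<Rightarrow> gas_state \<Rightarrow> real \<Rightarrow> real \<Rightarrow> real" where
  "defect' \<gamma> s l y1 y3 = (let P = (s + (y1 + y3) / 4)\<^sup>2 in
     hugoniot_scale \<gamma> (rho l) (prs l) P / 2
     + ((y3 - y1) / 2 * hugoniot_scale' \<gamma> (rho l) (prs l) P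
        + velocity_drop' \<gamma> (rho l) (prs l) P) * ((s + (y1 + y3) / 4) / 2))"

lemma shock_den_pos:
  assumes "1 < \<gamma>" "0 \<le> p" "0 \<le> q" "0 < p \<or> 0 < q"
  shows "0 < shock_den \<gamma> p q"
  using assms unfolding shock_den_def
  by (auto intro: add_pos_nonneg add_nonneg_pos)

lemma velocity_drop_deriv:
  assumes "1 < \<gamma>" "0 < rl" "0 < pl" "0 \<le> p"
  shows "(velocity_drop \<gamma> rl pl has_real_derivative velocity_drop' \<gamma> rl pl p) (at p)"
proof -
  define N where "N = shock_den \<gamma> p pl"
  have N: "0 < N" using assms by (simp add: N_def shock_den_pos)
  have "((\<lambda>p. 2 / (rl * shock_den \<gamma> p pl)) has_real_derivative - 2 * (\<gamma> + 1) / (rl * N\<^sup>2)) (at p)"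
    using N assms unfolding N_def shock_den_def
    by (auto intro!: derivative_eq_intros simp: divide_simps power2_eq_square)
  from DERIV_real_sqrt[THEN DERIV_chain2, OF _ this] N assms
  have "((\<lambda>p. sqrt (2 / (rl * shock_den \<gamma> p pl))) has_real_derivative
      inverse (sqrt (2 / (rl * N))) / 2 * (- 2 * (\<gamma> + 1) / (rl * N\<^sup>2))) (at p)"
    by (simp add: N_def)
  moreover have "((\<lambda>p. p - pl) has_real_derivative 1) (at p)"
    by (auto intro!: derivative_eq_intros)
  ultimately have "(velocity_drop \<gamma> rl pl has_real_derivative
      (p - pl) * (inverse (sqrt (2 / (rl * N))) / 2 * (- 2 * (\<gamma> + 1) / (rl * N\<^sup>2)))
        + 1 * sqrt (2 / (rl * N))) (at p)"
    unfolding velocity_drop_def[abs_def] N_def by (intro DERIV_mult')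
  \<comment> \<open>Turns the reciprocal of the root into a multiple of the root, which can then be
    factored out.\<close>
  moreover have "inverse (sqrt (2 / (rl * N))) = sqrt (2 / (rl * N)) * (rl * N / 2)"
  proof -
    have "sqrt (2 / (rl * N)) * sqrt (2 / (rl * N)) = 2 / (rl * N)"
      using N assms by (intro real_sqrt_mult_self[THEN trans]) auto
    then show ?thesis using N assms
      by (intro inverse_unique) (simp add: mult.assoc[symmetric])
  qed
  ultimately show ?thesis
    using N assms unfolding velocity_drop'_def N_def[symmetric]
    by (elim DERIV_cong) (simp add: field_simps power2_eq_square)
qed

lemma hugoniot_scale_pos:
  assumes "1 < \<gamma>" "0 < rl" "0 < pl" "0 \<le> p"
  shows "0 < hugoniot_scale \<gamma> rl pl p"
  using assms by (simp add: hugoniot_scale_def shock_den_pos)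

lemma hugoniot_scale_deriv:
  assumes "1 < \<gamma>" "0 < rl" "0 < pl" "0 \<le> p"
  shows "(hugoniot_scale \<gamma> rl pl has_real_derivative hugoniot_scale' \<gamma> rl pl p) (at p)"
proof -
  define N where "N = shock_den \<gamma> p pl"
  have N: "0 < N" using assms by (simp add: N_def shock_den_pos)
  have "((\<lambda>p. shock_den \<gamma> pl p / (\<gamma> * rl * shock_den \<gamma> p pl)) has_real_derivative
      - 4 * pl / (rl * N\<^sup>2)) (at p)"
    using N assms unfolding N_def shock_den_def
    by (auto intro!: derivative_eq_intros simp: divide_simps power2_eq_square) (simp add: algebra_simps)
  moreover have "0 < shock_den \<gamma> pl p / (\<gamma> * rl * N)"
    using assms N by (simp add: shock_den_pos)
  ultimately have "((\<lambda>p. sqrt (shock_den \<gamma> pl p / (\<gamma> * rl * shock_den \<gamma> p pl))) has_real_derivative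
      inverse (hugoniot_scale \<gamma> rl pl p) / 2 * (- 4 * pl / (rl * N\<^sup>2))) (at p)"
    unfolding hugoniot_scale_def N_def by (intro DERIV_real_sqrt[THEN DERIV_chain2])
  moreover have "hugoniot_scale \<gamma> rl pl =
      (\<lambda>p. sqrt (shock_den \<gamma> pl p / (\<gamma> * rl * shock_den \<gamma> p pl)))"
    by (simp add: hugoniot_scale_def fun_eq_iff)
  ultimately show ?thesis
    unfolding hugoniot_scale'_def N_def[symmetric] by (simp add: field_simps)
qed

lemma defect_deriv:
  assumes "1 < \<gamma>" "0 < rho l" "0 < prs l"
  shows "(defect \<gamma> v s l y1 has_real_derivative defect' \<gamma> s l y1 y3) (at y3)"
proof -
  have P: "((\<lambda>y. (s + (y1 + y) / 4)\<^sup>2) has_real_derivative (s + (y1 + y3) / 4) / 2) (at y3)"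
    by (auto intro!: derivative_eq_intros)
  note D = hugoniot_scale_deriv[THEN DERIV_chain2, OF assms _ P]
    velocity_drop_deriv[THEN DERIV_chain2, OF assms _ P]
  let ?P = "(s + (y1 + y3) / 4)\<^sup>2" and ?P' = "(s + (y1 + y3) / 4) / 2"
  have "((\<lambda>y. v - vel l + (y - y1) / 2 * hugoniot_scale \<gamma> (rho l) (prs l) ((s + (y1 + y) / 4)\<^sup>2)
      + velocity_drop \<gamma> (rho l) (prs l) ((s + (y1 + y) / 4)\<^sup>2)) has_real_derivative
      0 + ((y3 - y1) / 2 * (hugoniot_scale' \<gamma> (rho l) (prs l) ?P * ?P')
        + 1 / 2 * hugoniot_scale \<gamma> (rho l) (prs l) ?P)
      + velocity_drop' \<gamma> (rho l) (prs l) ?P * ?P') (at y3)"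
    by (intro DERIV_add DERIV_const DERIV_mult' D) (auto intro!: derivative_eq_intros)
  moreover have "0 + (c * (h' * X) + 1 / 2 * h) + d * X = h / 2 + (c * h' + d) * X" for c h h' d X :: real
    by (simp add: algebra_simps)
  ultimately show ?thesis
    unfolding defect_def[abs_def] defect'_def Let_def by (rule DERIV_cong)
qed

lemma tendsto_shock_den:
  assumes "(p \<longlongrightarrow> p0) F" "(q \<longlongrightarrow> q0) F"
  shows "((\<lambda>z. shock_den \<gamma> (p z) (q z)) \<longlongrightarrow> shock_den \<gamma> p0 q0) F"
  unfolding shock_den_def by (intro tendsto_intros assms)

section \<open>Continuity of the reduced relation along an arbitrary filter\<close>

context
  fixes \<gamma> s0 y0 y0' v0 :: real and l0 :: gas_state and F :: "'a filter"
    and s y1 y3 v :: "'a \<Rightarrow> real" and l :: "'a \<Rightarrow> gas_state"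
  assumes g: "1 < \<gamma>" and pos: "0 < rho l0" "0 < prs l0"
    and lim: "((\<lambda>z. rho (l z)) \<longlongrightarrow> rho l0) F" "((\<lambda>z. vel (l z)) \<longlongrightarrow> vel l0) F"
      "((\<lambda>z. prs (l z)) \<longlongrightarrow> prs l0) F" "(s \<longlongrightarrow> s0) F" "(v \<longlongrightarrow> v0) F"
      "(y1 \<longlongrightarrow> y0) F" "(y3 \<longlongrightarrow> y0') F"
begin

lemma shock_den_nonzero: "shock_den \<gamma> p (prs l0) \<noteq> 0" "shock_den \<gamma> (prs l0) p \<noteq> 0" if "0 \<le> p" for p
  using shock_den_pos[of \<gamma> p "prs l0"] shock_den_pos[of \<gamma> "prs l0" p] g pos that by auto

lemma tendsto_hugoniot_density:
  "((\<lambda>z. hugoniot_density \<gamma> (rho (l z)) (prs (l z)) ((s z + (y1 z + y3 z) / 4)\<^sup>2)) \<longlongrightarrow>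
     hugoniot_density \<gamma> (rho l0) (prs l0) ((s0 + (y0 + y0') / 4)\<^sup>2)) F"
  unfolding hugoniot_density_def
  by (intro tendsto_intros tendsto_shock_den lim) (use shock_den_nonzero in auto)

lemma tendsto_hugoniot_scale:
  "((\<lambda>z. hugoniot_scale \<gamma> (rho (l z)) (prs (l z)) ((s z + (y1 z + y3 z) / 4)\<^sup>2)) \<longlongrightarrow>
     hugoniot_scale \<gamma> (rho l0) (prs l0) ((s0 + (y0 + y0') / 4)\<^sup>2)) F"
  unfolding hugoniot_scale_def
  by (intro tendsto_intros tendsto_shock_den lim) (use shock_den_nonzero pos g in auto)

lemma tendsto_defect:
  "((\<lambda>z. defect \<gamma> (v z) (s z) (l z) (y1 z) (y3 z)) \<longlongrightarrow> defect \<gamma> v0 s0 l0 y0 y0') F"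
  unfolding defect_def Let_def velocity_drop_def
  by (intro tendsto_intros tendsto_shock_den tendsto_hugoniot_scale lim) (use shock_den_nonzero pos g in auto)

lemma tendsto_defect':
  "((\<lambda>z. defect' \<gamma> (s z) (l z) (y1 z) (y3 z)) \<longlongrightarrow> defect' \<gamma> s0 l0 y0 y0') F"
  unfolding defect'_def Let_def velocity_drop'_def hugoniot_scale'_def
  by (intro tendsto_intros tendsto_shock_den tendsto_hugoniot_scale lim)
    (use shock_den_nonzero pos g hugoniot_scale_pos[OF g pos] in \<open>auto simp: less_imp_neq[THEN not_sym]\<close>)

end

text \<open>For fixed pressures the second relation is linear in the downstream density. Its
  solution makes the density jump a multiple of the pressure jump, so the product of the two roots
  contains the root of a square, whose sign is fixed by \<open>prs l < prs r\<close>.\<close>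

lemma shock_relations_iff:
  assumes g: "1 < \<gamma>" and pos: "0 < rho l" "0 < prs l" "prs l < prs r" "0 < rho r"
  shows "shock_relations \<gamma> l r \<longleftrightarrow> rho r = hugoniot_density \<gamma> (rho l) (prs l) (prs r) \<and>
    vel r - vel l + velocity_drop \<gamma> (rho l) (prs l) (prs r) = 0"
proof -
  define N where "N = shock_den \<gamma> (prs r) (prs l)"
  define N' where "N' = shock_den \<gamma> (prs l) (prs r)"
  have N: "0 < N" "0 < N'" using g pos by (auto simp: N_def N'_def shock_den_pos)
  have "((\<gamma> - 1) / 2 * rho r - (\<gamma> + 1) / 2 * rho l) * (prs r - prs l)
       + \<gamma> * prs l * (rho r - rho l) = (rho r * N' - rho l * N) / 2"
    by (simp add: N_def N'_def shock_den_def field_simps)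
  then have hug: "((\<gamma> - 1) / 2 * rho r - (\<gamma> + 1) / 2 * rho l) * (prs r - prs l)
       + \<gamma> * prs l * (rho r - rho l) = 0 \<longleftrightarrow> rho r = hugoniot_density \<gamma> (rho l) (prs l) (prs r)"
    using N by (auto simp: hugoniot_density_def N_def[symmetric] N'_def[symmetric] field_simps)
  have "sqrt (prs r - prs l) * sqrt (rho r - rho l) + sqrt (rho r * rho l) * (vel r - vel l) = 0 \<longleftrightarrow>
      vel r - vel l + velocity_drop \<gamma> (rho l) (prs l) (prs r) = 0"
    if R: "rho r = hugoniot_density \<gamma> (rho l) (prs l) (prs r)"
  proof -
    have "rho r - rho l = rho r * rho l * (prs r - prs l) * (2 / (rho l * N))"
    proof -
      have diff: "prs r - prs l = (N - N') / 2" by (simp add: N_def N'_def shock_den_def algebra_simps)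
      have den: "rho r = rho l * N / N'"
        using R by (simp add: hugoniot_density_def N_def N'_def)
      show ?thesis unfolding diff den using N pos by (simp add: field_simps)
    qed
    then have "sqrt (prs r - prs l) * sqrt (rho r - rho l) =
        sqrt (rho r * rho l * (2 / (rho l * N)) * (prs r - prs l)\<^sup>2)"
      by (simp add: real_sqrt_mult[symmetric] power2_eq_square mult_ac)
    also have "\<dots> = sqrt (rho r * rho l) * velocity_drop \<gamma> (rho l) (prs l) (prs r)"
      using pos unfolding velocity_drop_def N_def[symmetric] by (simp add: real_sqrt_mult real_sqrt_divide)
    finally have "sqrt (prs r - prs l) * sqrt (rho r - rho l) + sqrt (rho r * rho l) * (vel r - vel l)
       = sqrt (rho r * rho l) * (vel r - vel l + velocity_drop \<gamma> (rho l) (prs l) (prs r))"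
      by (simp add: algebra_simps)
    then show ?thesis using pos by simp
  qed
  with hug show ?thesis unfolding shock_relations_def by blast
qed

text \<open>The pressure \<open>P\<close> does not involve \<open>y2\<close>, and the Hugoniot
  relation fixes the density. Hence \<open>y2\<close> becomes explicit and only \<open>y3\<close> is
  left to an implicit equation.\<close>

lemma shock_relations_right_state_iff:
  assumes g: "1 < \<gamma>" and b: "0 < rho b" "0 < prs b" and l: "0 < rho l" "0 < prs l"
    and y: "0 < sqrt (prs b) + (y1 + y3) / 4" "prs l < (sqrt (prs b) + (y1 + y3) / 4)\<^sup>2"
  defines "P \<equiv> (sqrt (prs b) + (y1 + y3) / 4)\<^sup>2"
  shows "shock_relations \<gamma> l (right_state \<gamma> b y1 y2 y3) \<longleftrightarrow>
    y2 = ln P - \<gamma> * ln (hugoniot_density \<gamma> (rho l) (prs l) P) - (ln (prs b) - \<gamma> * ln (rho b)) \<and>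
    defect \<gamma> (vel b) (sqrt (prs b)) l y1 y3 = 0"
proof -
  define H where "H = hugoniot_density \<gamma> (rho l) (prs l) P"
  define R where "R = rho b * (P / prs b * exp (- y2)) powr (1 / \<gamma>)"
  have P: "0 < P" "prs l < P" using y by (auto simp: P_def)
  have R: "0 < R" using b P by (simp add: R_def)
  have H: "0 < H" using g l P by (simp add: H_def hugoniot_density_def shock_den_pos)
  have rs: "right_state \<gamma> b y1 y2 y3 = Gas R (vel b + (y3 - y1) / (2 * sqrt (\<gamma> * R))) P"
    using right_state_eq[of \<gamma> b y1 y3 y2] g b y by (simp add: R_def P_def)
  have "ln R = ln (rho b) + (ln P - ln (prs b) - y2) / \<gamma>"
    using b P by (simp add: R_def ln_mult ln_div ln_powr)
  then have "\<gamma> * ln R = \<gamma> * ln (rho b) + (ln P - ln (prs b) - y2)"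
    using g by (simp add: field_simps)
  \<comment> \<open>Densities are compared through logarithms, where \<open>y2\<close> enters
    linearly.\<close>
  moreover have "R = H \<longleftrightarrow> \<gamma> * ln R = \<gamma> * ln H" using R H g by simp
  ultimately have RH: "R = H \<longleftrightarrow> y2 = ln P - \<gamma> * ln H - (ln (prs b) - \<gamma> * ln (rho b))"
    by auto
  have "hugoniot_scale \<gamma> (rho l) (prs l) P = 1 / sqrt (\<gamma> * H)"
    unfolding hugoniot_scale_def H_def hugoniot_density_def
    by (simp add: real_sqrt_divide real_sqrt_mult)
  then have "defect \<gamma> (vel b) (sqrt (prs b)) l y1 y3 =
      vel b + (y3 - y1) / (2 * sqrt (\<gamma> * H)) - vel l + velocity_drop \<gamma> (rho l) (prs l) P"
    by (simp add: defect_def Let_def P_def)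
  then show ?thesis
    using shock_relations_iff[OF g l, of "right_state \<gamma> b y1 y2 y3"] P R RH
    unfolding rs by (auto simp: H_def[symmetric])
qed

section \<open>The background shock\<close>

text \<open>The two sides of a steady shock are parametrised by the mass flux \<open>m\<close> and the two velocities
  \<open>u < w\<close>; \<open>k\<close> is the logarithmic derivative of the area at the shock.\<close>

locale transonic_background =
  fixes \<gamma> xs :: real and Um Up :: "real \<Rightarrow> gas_state" and m w u k :: real
  assumes \<gamma>: "1 < \<gamma>" and \<gamma>3: "\<gamma> < 3" and m: "0 < m" and u: "0 < u" and uw: "u < w" and k: "0 < k"
    and C: "0 < (\<gamma> + 1) * u - (\<gamma> - 1) * w"
    and left: "rho (Um xs) = m / w" "vel (Um xs) = w"
      "prs (Um xs) = m * ((\<gamma> + 1) * u - (\<gamma> - 1) * w) / (2 * \<gamma>)"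
    and right: "rho (Up xs) = m / u" "vel (Up xs) = u"
      "prs (Up xs) = m * ((\<gamma> + 1) * w - (\<gamma> - 1) * u) / (2 * \<gamma>)"
    and left_deriv:
      "((\<lambda>x. rho (Um x)) has_real_derivative - (2 * k * m / ((\<gamma> + 1) * (w - u)))) (at xs)"
      "((\<lambda>x. vel (Um x)) has_real_derivative
          k * ((\<gamma> + 1) * u - (\<gamma> - 1) * w) * w / ((\<gamma> + 1) * (w - u))) (at xs)"
      "((\<lambda>x. prs (Um x)) has_real_derivative
          - (k * m * ((\<gamma> + 1) * u - (\<gamma> - 1) * w) * w / ((\<gamma> + 1) * (w - u)))) (at xs)"
    and right_deriv:
      "((\<lambda>x. rho (Up x)) has_real_derivative 2 * k * m / ((\<gamma> + 1) * (w - u))) (at xs)"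
      "((\<lambda>x. vel (Up x)) has_real_derivative
          - (k * ((\<gamma> + 1) * w - (\<gamma> - 1) * u) * u / ((\<gamma> + 1) * (w - u)))) (at xs)"
      "((\<lambda>x. prs (Up x)) has_real_derivative
          k * m * ((\<gamma> + 1) * w - (\<gamma> - 1) * u) * u / ((\<gamma> + 1) * (w - u))) (at xs)"

text \<open>Mass conservation gives the densities, \<open>rankine_hugoniot_prs\<close> in both
  directions the pressures, and \<open>steady_flow_derivs\<close> the slopes. Positivity of
  \<open>k\<close> is the divergence of the nozzle.\<close>

lemma steady_transonic_shock_background:
  assumes shock: "steady_transonic_shock \<gamma> L a xs Um Up" and g: "1 < \<gamma>" "\<gamma> < 3"
  shows "\<exists>k. transonic_background \<gamma> xs Um Up (mass_flux (Up xs)) (vel (Um xs)) (vel (Up xs)) k"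
proof -
  define m w u k where "m = mass_flux (Up xs)" and "w = vel (Um xs)" and "u = vel (Up xs)"
    and "k = interval_deriv L a xs / a xs"
  define B C where "B = (\<gamma> + 1) * w - (\<gamma> - 1) * u" and "C = (\<gamma> + 1) * u - (\<gamma> - 1) * w"
  have xs: "0 < xs" "xs < L" and nozzle: "divergent_nozzle L a"
    and flux: "mass_flux (Um xs) = mass_flux (Up xs)" "momentum_flux (Um xs) = momentum_flux (Up xs)"
      "energy_flux \<gamma> (Um xs) = energy_flux \<gamma> (Up xs)"
    and super: "sound_speed \<gamma> (Um xs) < vel (Um xs)"
    and sub: "vel (Up xs) < sound_speed \<gamma> (Up xs)"
    using shock by (auto simp: steady_transonic_shock_def)
  from nozzle obtain c where "0 < c" "\<forall>x\<in>{0..L}. c \<le> interval_deriv L a x / a x"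
    unfolding divergent_nozzle_def by blast
  then have k: "0 < k"
    using xs unfolding k_def by (auto intro: less_le_trans)
  from shock obtain e where e: "0 < e" "e \<le> xs" "e \<le> L - xs"
    and flow: "steady_flow \<gamma> L a {0..xs + e} Um" "steady_flow \<gamma> L a {xs - e..L} Up"
    by (auto simp: steady_transonic_shock_def)
  have int: "xs \<in> interior {0..xs + e}" "xs \<in> interior {xs - e..L}"
    using xs e by auto
  then have pos: "positive_state (Um xs)" "positive_state (Up xs)"
    using flow interior_subset unfolding steady_flow_def by blast+
  then have wu: "0 < w" "0 < u" "0 < m"
    by (auto simp: positive_state_def w_def u_def m_def mass_flux_def)
  have rho: "rho (Um xs) = m / w" "rho (Up xs) = m / u"
    using flux(1) wu by (auto simp: m_def w_def u_def mass_flux_def field_simps)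
  have mach: "\<gamma> * prs (Um xs) < m * w" "m * u < \<gamma> * prs (Up xs)"
    using super sub sound_speed_less_iff(1)[OF pos(1)] sound_speed_less_iff(2)[OF pos(2)] g wu rho
    by (auto simp: w_def[symmetric] u_def[symmetric] power2_eq_square)
  \<comment> \<open>Equal velocities would force equal pressures, but the same state cannot be both
    supersonic and subsonic.\<close>
  have "w \<noteq> u"
  proof
    assume "w = u"
    moreover have "m * w + prs (Um xs) = m * u + prs (Up xs)"
      using flux(2) rho wu by (simp add: momentum_flux_def w_def[symmetric] u_def[symmetric] power2_eq_square)
    ultimately show False using mach by simp
  qed
  then have prs: "2 * \<gamma> * prs (Up xs) = m * B" "2 * \<gamma> * prs (Um xs) = m * C"
    using rankine_hugoniot_prs[of "Um xs" "Up xs" \<gamma>] rankine_hugoniot_prs[of "Up xs" "Um xs" \<gamma>] pos g flux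
    by (auto simp: m_def w_def u_def B_def C_def)
  have "0 < m * C" unfolding prs(2)[symmetric] using g pos by (simp add: positive_state_def)
  then have C: "0 < C" using wu by (simp add: zero_less_mult_iff)
  \<comment> \<open>The subsonic condition on the right, which amounts to
    \<open>u < w\<close>.\<close>
  have "m * (2 * u) < m * B" using mach(2) prs(1) by simp
  then have "2 * u < B" using wu by simp
  then have "(\<gamma> + 1) * u < (\<gamma> + 1) * w" by (simp add: B_def algebra_simps)
  then have "u < w" using g by simp
  define d where "d = (\<gamma> + 1) * (w - u)"
  have d: "0 < d" using \<open>u < w\<close> g by (simp add: d_def)
  have gp: "\<gamma> * prs (Up xs) = m * B / 2" "\<gamma> * prs (Um xs) = m * C / 2"
    using prs by auto
  \<comment> \<open>The two deviations from sonic flow agree up to sign, so all background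
    derivatives share the denominator \<open>d\<close>.\<close>
  have den: "\<gamma> * prs (Up xs) - rho (Up xs) * (vel (Up xs))\<^sup>2 = m * d / 2"
      "\<gamma> * prs (Um xs) - rho (Um xs) * (vel (Um xs))\<^sup>2 = - (m * d / 2)"
    using rho wu
    by (auto simp: gp d_def B_def C_def w_def[symmetric] u_def[symmetric] power2_eq_square field_simps)
  have p: "prs (Up xs) = m * B / (2 * \<gamma>)" "prs (Um xs) = m * C / (2 * \<gamma>)"
    using prs g by (auto simp: field_simps)
  have "\<gamma> * prs (Up xs) \<noteq> rho (Up xs) * (vel (Up xs))\<^sup>2" "\<gamma> * prs (Um xs) \<noteq> rho (Um xs) * (vel (Um xs))\<^sup>2"
    using den d wu by auto
  note D = steady_flow_derivs[OF flow(1) int(1) g(1) this(2)] steady_flow_derivs[OF flow(2) int(2) g(1) this(1)]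
  note D = D[unfolded den, folded k_def u_def w_def, unfolded rho p]
  have "transonic_background \<gamma> xs Um Up m w u k"
    unfolding transonic_background_def B_def[symmetric] C_def[symmetric] d_def[symmetric]
    using g wu \<open>u < w\<close> k C rho p d
    by (auto intro!: D[THEN DERIV_cong] simp: w_def[symmetric] u_def[symmetric])
      (auto simp: power2_eq_square)
  then show ?thesis by (auto simp: m_def w_def u_def)
qed

section \<open>Explicit values at the background shock\<close>

context transonic_background
begin

definition p where "p = prs (Up xs)"
definition q where "q = sqrt p"
definition B where "B = (\<gamma> + 1) * w - (\<gamma> - 1) * u"
definition M where "M = sqrt (2 * u / B)"
text \<open>Divided by \<open>m\<close>, this is the pressure derivative of
  \<open>velocity_drop\<close> at the background; see \<open>drop'_value\<close>.\<close>

definition \<sigma> where "\<sigma> = ((3 - \<gamma>) * w + (\<gamma> + 1) * u) / (4 * w)"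
abbreviation "l0 \<equiv> Um xs"
abbreviation "d \<equiv> (\<gamma> + 1) * (w - u)"

lemma w: "0 < w" using u uw by simp

lemma two_u_less_B: "2 * u < B"
proof -
  have "(\<gamma> + 1) * u < (\<gamma> + 1) * w" using uw \<gamma> by simp
  then show ?thesis by (simp add: B_def algebra_simps)
qed

lemma B_pos: "0 < B" using two_u_less_B u by simp

lemma p: "p = m * B / (2 * \<gamma>)" "0 < p"
  using right m \<gamma> B_pos by (auto simp: p_def B_def)

lemma q: "0 < q" "q\<^sup>2 = p" using p by (auto simp: q_def)

lemma prs_diff: "p - prs l0 = m * (w - u)"
  unfolding p_def left right using \<gamma> by (simp add: divide_simps) (simp add: algebra_simps)

lemma prs_left: "prs l0 < p" "0 < prs l0" and rho_left: "0 < rho l0" and rho_right: "0 < rho (Up xs)"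
proof -
  show "prs l0 < p" using prs_diff uw m by (metis diff_gt_0_iff_gt mult_pos_pos)
qed (use left right m w u C \<gamma> in auto)

lemma M: "0 < M" "M\<^sup>2 = 2 * u / B" and mach_eq: "mach \<gamma> (Up xs) = M"
proof -
  have "0 < 2 * u / B" using u B_pos by simp
  then show "0 < M" "M\<^sup>2 = 2 * u / B"
    unfolding M_def by (auto simp del: zero_less_divide_iff)
  have "mach \<gamma> (Up xs) = u / sqrt (B * u / 2)"
    using right m \<gamma> by (simp add: mach_def sound_speed_def B_def)
  also have "\<dots> = sqrt (u\<^sup>2 / (B * u / 2))" using u by (simp only: real_sqrt_divide real_sqrt_abs abs_of_pos)
  also have "\<dots> = M" 
  proof -
    have "u\<^sup>2 / (B * u / 2) = 2 * u / B" using u by (simp add: power2_eq_square)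
    then show ?thesis by (simp only: M_def)
  qed
  finally show "mach \<gamma> (Up xs) = M" .
qed

lemma den_values: "shock_den \<gamma> p (prs l0) = 2 * m * w" "shock_den \<gamma> (prs l0) p = 2 * m * u"
  unfolding shock_den_def left p B_def using \<gamma> by (auto simp: field_simps)

lemma density_value: "hugoniot_density \<gamma> (rho l0) (prs l0) p = rho (Up xs)"
  unfolding hugoniot_density_def den_values using w u m by (simp add: left(1) right(1))

lemma sqrt_value: "sqrt (2 / (rho l0 * (2 * m * w))) = 1 / m"
  using w m by (simp add: left real_sqrt_divide)

lemma drop_value: "velocity_drop \<gamma> (rho l0) (prs l0) p = w - u"
  unfolding velocity_drop_def den_values sqrt_value prs_diff using m by simp

lemma drop'_value: "velocity_drop' \<gamma> (rho l0) (prs l0) p = \<sigma> / m"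
  unfolding velocity_drop'_def den_values sqrt_value prs_diff
  using m w by (simp add: \<sigma>_def field_simps)

text \<open>Density times sound speed is \<open>sqrt (\<gamma> * rho * p)\<close>, so
  \<open>1 / sqrt (\<gamma> * rho)\<close> is \<open>q\<close> over that product; \<open>m\<close>
  is density times velocity, which brings in the Mach number.\<close>

lemma scale_value: "hugoniot_scale \<gamma> (rho l0) (prs l0) p = q * M / m"
proof -
  have "hugoniot_scale \<gamma> (rho l0) (prs l0) p = sqrt (u / (\<gamma> * m))"
    unfolding hugoniot_scale_def den_values using m w by (simp add: left field_simps)
  also have "\<dots> = sqrt (p * (2 * u / B) / m\<^sup>2)"
    using m B_pos \<gamma> by (simp add: p power2_eq_square field_simps)
  also have "\<dots> = q * M / m"
    using m by (simp add: q_def M_def real_sqrt_mult real_sqrt_divide)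
  finally show ?thesis .
qed

section \<open>The scalar equation near the background\<close>

definition perturbed_left :: "real \<times> real \<times> real \<times> real \<times> real \<Rightarrow> gas_state" where
  "perturbed_left a = (case a of (x, y1, r, v, h) \<Rightarrow> left_state (Um x) r v h)"

text \<open>The five parameters are bundled into one point of a metric space, leaving the third
  perturbation variable as the unknown.\<close>

definition G :: "real \<times> real \<times> real \<times> real \<times> real \<Rightarrow> real \<Rightarrow> real" where
  "G a = defect \<gamma> (vel (Up (fst a))) (sqrt (prs (Up (fst a)))) (perturbed_left a) (fst (snd a))"

definition G' :: "real \<times> real \<times> real \<times> real \<times> real \<Rightarrow> real \<Rightarrow> real" where
  "G' a = defect' \<gamma> (sqrt (prs (Up (fst a)))) (perturbed_left a) (fst (snd a))"

abbreviation a0 :: "real \<times> real \<times> real \<times> real \<times> real" where "a0 \<equiv> (xs, 0, 0, 0, 0)"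

lemma perturbed_left_a0: "perturbed_left a0 = l0"
  by (simp add: perturbed_left_def left_state_def)

lemma background_tendsto:
  assumes "(a \<longlongrightarrow> a0) F"
  shows "((\<lambda>z. rho (perturbed_left (a z))) \<longlongrightarrow> rho l0) F"
    "((\<lambda>z. vel (perturbed_left (a z))) \<longlongrightarrow> vel l0) F"
    "((\<lambda>z. prs (perturbed_left (a z))) \<longlongrightarrow> prs l0) F"
    "((\<lambda>z. rho (Up (fst (a z)))) \<longlongrightarrow> rho (Up xs)) F"
    "((\<lambda>z. vel (Up (fst (a z)))) \<longlongrightarrow> u) F"
    "((\<lambda>z. prs (Up (fst (a z)))) \<longlongrightarrow> p) F"
    "((\<lambda>z. sqrt (prs (Up (fst (a z))))) \<longlongrightarrow> q) F"
    "((\<lambda>z. fst (snd (a z))) \<longlongrightarrow> 0) F"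
proof -
  note x = tendsto_fst[OF assms, simplified]
  note L = left_deriv[THEN DERIV_isCont, THEN isCont_tendsto_compose, OF x]
  note R = right_deriv[THEN DERIV_isCont, THEN isCont_tendsto_compose, OF x]
  note s1 = tendsto_snd[OF assms, simplified]
  note s2 = tendsto_snd[OF s1, simplified]
  note s3 = tendsto_snd[OF s2, simplified]
  have "((\<lambda>z. rho (Um (fst (a z))) + fst (snd (snd (a z)))) \<longlongrightarrow> rho l0 + 0) F"
    "((\<lambda>z. vel (Um (fst (a z))) + fst (snd (snd (snd (a z))))) \<longlongrightarrow> vel l0 + 0) F"
    "((\<lambda>z. prs (Um (fst (a z))) + snd (snd (snd (snd (a z))))) \<longlongrightarrow> prs l0 + 0) F"
    using tendsto_fst[OF s2] tendsto_fst[OF s3] tendsto_snd[OF s3]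
    by (intro tendsto_add L; simp)+
  then show "((\<lambda>z. rho (perturbed_left (a z))) \<longlongrightarrow> rho l0) F"
    "((\<lambda>z. vel (perturbed_left (a z))) \<longlongrightarrow> vel l0) F"
    "((\<lambda>z. prs (perturbed_left (a z))) \<longlongrightarrow> prs l0) F"
    by (simp_all add: perturbed_left_def left_state_def case_prod_unfold)
  show "((\<lambda>z. rho (Up (fst (a z)))) \<longlongrightarrow> rho (Up xs)) F"
    "((\<lambda>z. vel (Up (fst (a z)))) \<longlongrightarrow> u) F"
    "((\<lambda>z. prs (Up (fst (a z)))) \<longlongrightarrow> p) F"
    using R right by (auto simp: p_def)
  then show "((\<lambda>z. sqrt (prs (Up (fst (a z))))) \<longlongrightarrow> q) F"
    unfolding q_def by (intro tendsto_real_sqrt)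
  show "((\<lambda>z. fst (snd (a z))) \<longlongrightarrow> 0) F"
    using tendsto_fst[OF s1] by simp
qed

lemma G_tendsto:
  assumes "(a \<longlongrightarrow> a0) F" "(y \<longlongrightarrow> y0) F"
  shows "((\<lambda>z. G (a z) (y z)) \<longlongrightarrow> G a0 y0) F" "((\<lambda>z. G' (a z) (y z)) \<longlongrightarrow> G' a0 y0) F"
  using tendsto_defect[OF \<gamma> rho_left prs_left(2) background_tendsto(1-3,7,5,8)[OF assms(1)] assms(2)]
    tendsto_defect'[OF \<gamma> rho_left prs_left(2) background_tendsto(1-3,7,5,8)[OF assms(1)] assms(2)]
  by (auto simp: G_def G'_def perturbed_left_a0 right q_def p_def)

lemma G_deriv:
  "\<forall>\<^sub>F a in nhds a0. \<forall>y. (G a has_real_derivative G' a y) (at y)"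
proof -
  note lim = background_tendsto[OF filterlim_ident]
  have "\<forall>\<^sub>F a in nhds a0. 0 < rho (perturbed_left a)" "\<forall>\<^sub>F a in nhds a0. 0 < prs (perturbed_left a)"
    using order_tendstoD(1)[OF lim(1) rho_left] order_tendstoD(1)[OF lim(3) prs_left(2)] by auto
  then show ?thesis
    by eventually_elim (auto simp: G_def G'_def intro!: defect_deriv \<gamma>)
qed

lemma G_a0: "G a0 0 = 0"
  using q by (simp add: G_def defect_def perturbed_left_a0 left(2) right(2) p_def[symmetric]
    drop_value q_def[symmetric] Let_def)

text \<open>At the background \<open>y3 - y1 = 0\<close>, so \<open>hugoniot_scale'\<close> drops
  out: \<open>M\<close> comes from differentiating the factor \<open>y3 - y1\<close>,
  \<open>\<sigma>\<close> from the velocity drop.\<close>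

lemma G'_a0: "G' a0 0 = q / (2 * m) * (M + \<sigma>)"
  using q m
  by (simp add: G'_def defect'_def perturbed_left_a0 p_def[symmetric] q_def[symmetric] Let_def
    scale_value drop'_value) (simp add: field_simps)

lemma G'_cont: "isCont (\<lambda>(a, y). G' a y) (a0, 0)"
  unfolding isCont_def case_prod_unfold
  by (simp only: fst_conv snd_conv, rule G_tendsto(2)) (auto intro!: tendsto_eq_intros)

lemma G_cont: "isCont (\<lambda>a. G a y) a0"
  unfolding isCont_def by (rule G_tendsto) (auto intro!: tendsto_eq_intros)

text \<open>The second perturbation variable forced by the Hugoniot density once \<open>y3\<close>
  is given.\<close>

definition Y2 :: "real \<times> real \<times> real \<times> real \<times> real \<Rightarrow> real \<Rightarrow> real" where
  "Y2 a y3 = (let P = (sqrt (prs (Up (fst a))) + (fst (snd a) + y3) / 4)\<^sup>2 in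
    ln P - \<gamma> * ln (hugoniot_density \<gamma> (rho (perturbed_left a)) (prs (perturbed_left a)) P)
      - (ln (prs (Up (fst a))) - \<gamma> * ln (rho (Up (fst a)))))"

lemma Y2_tendsto:
  assumes "(a \<longlongrightarrow> a0) F" "(y \<longlongrightarrow> 0) F"
  shows "((\<lambda>z. Y2 (a z) (y z)) \<longlongrightarrow> 0) F"
proof -
  note lim = background_tendsto[OF assms(1)]
  note H = tendsto_hugoniot_density[OF \<gamma> rho_left prs_left(2) lim(1-3,7,5,8) assms(2)]
  have "((\<lambda>z. Y2 (a z) (y z)) \<longlongrightarrow> ln ((q + (0 + 0) / 4)\<^sup>2)
      - \<gamma> * ln (hugoniot_density \<gamma> (rho l0) (prs l0) ((q + (0 + 0) / 4)\<^sup>2))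
      - (ln p - \<gamma> * ln (rho (Up xs)))) F"
    unfolding Y2_def Let_def
    by (intro tendsto_intros H lim assms) (use q p density_value rho_right in auto)
  then show ?thesis using q density_value by simp
qed

text \<open>The sign conditions of \<open>shock_relations_right_state_iff\<close> are strict and
  hold at the background, so by continuity they persist nearby.\<close>

lemma shock_relations_eventually:
  "\<forall>\<^sub>F ((x, y1, r, v, h), (y2, y3)) in nhds (a0, (0, 0)).
     shock_relations \<gamma> (left_state (Um x) r v h) (right_state \<gamma> (Up x) y1 y2 y3) \<longleftrightarrow>
     y2 = Y2 (x, y1, r, v, h) y3 \<and> G (x, y1, r, v, h) y3 = 0"
proof -
  let ?F = "nhds (a0, (0 :: real, 0 :: real))"
  have a: "(fst \<longlongrightarrow> a0) ?F" and y: "((\<lambda>z. snd (snd z)) \<longlongrightarrow> 0) ?F"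
    by (auto intro!: tendsto_eq_intros filterlim_ident)
  note lim = background_tendsto[OF a]
  have "((\<lambda>z. sqrt (prs (Up (fst (fst z)))) + (fst (snd (fst z)) + snd (snd z)) / 4) \<longlongrightarrow> q + (0 + 0) / 4) ?F"
    by (intro tendsto_intros lim y) simp
  then have s: "((\<lambda>z. sqrt (prs (Up (fst (fst z)))) + (fst (snd (fst z)) + snd (snd z)) / 4) \<longlongrightarrow> q) ?F"
    by simp
  have s2: "((\<lambda>z. (sqrt (prs (Up (fst (fst z)))) + (fst (snd (fst z)) + snd (snd z)) / 4)\<^sup>2
      - prs (perturbed_left (fst z))) \<longlongrightarrow> p - prs l0) ?F"
    unfolding q(2)[symmetric] by (intro tendsto_intros s lim)
  have "0 < p - prs l0" using prs_left by simp
  note this[THEN order_tendstoD(1)[OF s2]] order_tendstoD(1)[OF s q(1)]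
    order_tendstoD(1)[OF lim(1) rho_left] order_tendstoD(1)[OF lim(3) prs_left(2)]
    order_tendstoD(1)[OF lim(4) rho_right] order_tendstoD(1)[OF lim(6) p(2)]
  then show ?thesis
  proof eventually_elim
    case (elim z)
    obtain x y1 r v h y2 y3 where z: "z = ((x, y1, r, v, h), (y2, y3))" by (metis surj_pair)
    show ?case
      using elim shock_relations_right_state_iff[of \<gamma> "Up x" "left_state (Um x) r v h" y1 y3 y2] \<gamma>
      by (simp add: z perturbed_left_def Y2_def G_def Let_def)
  qed
qed

section \<open>Derivatives of the scalar equation in position and first variable\<close>

definition \<kappa> where "\<kappa> = k / d"
abbreviation "C \<equiv> (\<gamma> + 1) * u - (\<gamma> - 1) * w"

lemma k_eq: "k = \<kappa> * d"
  using uw \<gamma> by (simp add: \<kappa>_def)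

text \<open>Absorbing the common denominator into \<open>\<kappa>\<close> leaves polynomials in
  \<open>m\<close>, \<open>u\<close>, \<open>w\<close> and \<gamma>.\<close>

lemma background_deriv:
  "((\<lambda>x. rho (Um x)) has_real_derivative - 2 * \<kappa> * m) (at xs)"
  "((\<lambda>x. vel (Um x)) has_real_derivative \<kappa> * C * w) (at xs)"
  "((\<lambda>x. prs (Um x)) has_real_derivative - (\<kappa> * m * C * w)) (at xs)"
  "((\<lambda>x. rho (Up x)) has_real_derivative 2 * \<kappa> * m) (at xs)"
  "((\<lambda>x. vel (Up x)) has_real_derivative - (\<kappa> * B * u)) (at xs)"
  "((\<lambda>x. prs (Up x)) has_real_derivative \<kappa> * m * B * u) (at xs)"
  using left_deriv right_deriv by (auto simp: \<kappa>_def B_def elim!: DERIV_cong)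

text \<open>With \<open>y1 = y3 = 0\<close> the equation is the residual of the velocity relation
  between the two background branches.\<close>

lemma G_curve_x: "((\<lambda>x. G (x, 0, 0, 0, 0) 0) has_real_derivative
   k * (w - u) * ((3 - \<gamma>) * w - (\<gamma> - 1) * u) / (4 * w)) (at xs)"
proof -
  note D = background_deriv
  let ?N' = "(\<gamma> + 1) * (\<kappa> * m * B * u) + (\<gamma> - 1) * (- (\<kappa> * m * C * w))"
  let ?X' = "- 2 * (- 2 * \<kappa> * m * (2 * m * w) + m / w * ?N') / (2 * m\<^sup>2)\<^sup>2"
  have N: "((\<lambda>x. shock_den \<gamma> (prs (Up x)) (prs (Um x))) has_real_derivative ?N') (at xs)"
    unfolding shock_den_def by (intro DERIV_add DERIV_cmult D)
  have den: "rho l0 * shock_den \<gamma> (prs (Up xs)) (prs l0) = 2 * m\<^sup>2"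
    using den_values(1) w by (simp add: p_def left(1) power2_eq_square)
  have X: "((\<lambda>x. 2 / (rho (Um x) * shock_den \<gamma> (prs (Up x)) (prs (Um x)))) has_real_derivative ?X') (at xs)"
  proof (rule DERIV_cong[OF DERIV_divide[OF DERIV_const DERIV_mult[OF D(1) N]]])
    show "rho l0 * shock_den \<gamma> (prs (Up xs)) (prs l0) \<noteq> 0" using m by (simp add: den)
  qed (use den_values(1) in \<open>simp add: den p_def left(1) power2_eq_square mult_ac\<close>)
  have sq: "sqrt (2 / (rho l0 * shock_den \<gamma> (prs (Up xs)) (prs l0))) = 1 / m"
    using sqrt_value den_values(1) by (simp add: p_def)
  have "0 < 2 / (rho l0 * shock_den \<gamma> (prs (Up xs)) (prs l0))"
    using den_values(1) m w rho_left by (simp add: p_def)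
  from DERIV_real_sqrt[THEN DERIV_chain2, OF this X]
  have S: "((\<lambda>x. sqrt (2 / (rho (Um x) * shock_den \<gamma> (prs (Up x)) (prs (Um x))))) has_real_derivative
      m / 2 * ?X') (at xs)" by (simp add: sq)
  have "((\<lambda>x. vel (Up x) - vel (Um x) + velocity_drop \<gamma> (rho (Um x)) (prs (Um x)) (prs (Up x)))
      has_real_derivative - (\<kappa> * B * u) - \<kappa> * C * w +
        ((prs (Up xs) - prs l0) * (m / 2 * ?X') + (\<kappa> * m * B * u - - (\<kappa> * m * C * w)) * (1 / m))) (at xs)"
    unfolding velocity_drop_def sq[symmetric]
    by (intro DERIV_add DERIV_diff DERIV_mult' D S)
  moreover have "- (\<kappa> * B * u) - \<kappa> * C * w +
        (m * (w - u) * (m / 2 * ?X') + (\<kappa> * m * B * u - - (\<kappa> * m * C * w)) * (1 / m)) =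
      k * (w - u) * ((3 - \<gamma>) * w - (\<gamma> - 1) * u) / (4 * w)"
  proof -
    define n where "n = (\<gamma> + 1) * (B * u) - (\<gamma> - 1) * (C * w)"
    have N': "?N' = \<kappa> * m * n" by (simp add: n_def algebra_simps)
    \<comment> \<open>The factor \<open>d\<close> split off here cancels the denominator of
      \<open>\<kappa>\<close>.\<close>
    have n: "4 * w\<^sup>2 - n = d * ((3 - \<gamma>) * w - (\<gamma> - 1) * u)"
      by (simp add: n_def B_def algebra_simps power2_eq_square)
    have 1: "m * (w - u) * (m / 2 * ?X') = \<kappa> * (w - u) * (4 * w\<^sup>2 - n) / (4 * w)"
      unfolding N' using m w by (simp add: field_simps power2_eq_square)
    \<comment> \<open>On each branch the pressure derivative is \<open>- m\<close> times the
      velocity derivative, so these terms cancel the velocity slopes; only the change of the square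
      root survives.\<close>
    have 2: "(\<kappa> * m * B * u - - (\<kappa> * m * C * w)) * (1 / m) = \<kappa> * B * u + \<kappa> * C * w"
      using m by (simp add: field_simps)
    define Z where "Z = (3 - \<gamma>) * w - (\<gamma> - 1) * u"
    have "- a - b + (\<kappa> * (w - u) * (e * Z) / (4 * w) + (a + b)) = \<kappa> * e * (w - u) * Z / (4 * w)" for a b e
      by (simp add: mult_ac)
    from this[of _ _ d, folded k_eq] show ?thesis unfolding 1 2 n Z_def .
  qed
  moreover have "\<forall>\<^sub>F x in nhds xs. G (x, 0, 0, 0, 0) 0 =
      vel (Up x) - vel (Um x) + velocity_drop \<gamma> (rho (Um x)) (prs (Um x)) (prs (Up x))"
  proof -
    have "((\<lambda>x. (x, 0, 0, 0, 0)) \<longlongrightarrow> a0) (nhds xs)"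
      by (auto intro!: tendsto_intros filterlim_ident)
    from order_tendstoD(1)[OF background_tendsto(6)[OF this] p(2)] show ?thesis
      by eventually_elim (simp add: G_def defect_def perturbed_left_def left_state_def Let_def)
  qed
  ultimately show ?thesis
    using prs_diff by (simp add: p_def DERIV_cong_ev)
qed

text \<open>\<open>y1\<close> enters the pressure as \<open>y3\<close> does but the velocity with
  the opposite sign, hence \<open>\<sigma> - M\<close> in place of
  \<open>M + \<sigma>\<close>.\<close>

lemma G_curve_y: "((\<lambda>t. G (xs, t, 0, 0, 0) 0) has_real_derivative q / (2 * m) * (\<sigma> - M)) (at 0)"
proof -
  have pos: "0 \<le> (q + 0 / 4)\<^sup>2" by simp
  have P: "((\<lambda>t. (q + t / 4)\<^sup>2) has_real_derivative q / 2) (at 0)"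
    by (auto intro!: derivative_eq_intros)
  note D = hugoniot_scale_deriv[THEN DERIV_chain2, OF \<gamma> rho_left prs_left(2) pos P]
    velocity_drop_deriv[THEN DERIV_chain2, OF \<gamma> rho_left prs_left(2) pos P]
  have "((\<lambda>t. u - w + (0 - t) / 2 * hugoniot_scale \<gamma> (rho l0) (prs l0) ((q + t / 4)\<^sup>2)
      + velocity_drop \<gamma> (rho l0) (prs l0) ((q + t / 4)\<^sup>2)) has_real_derivative
      0 + ((0 - 0) / 2 * (hugoniot_scale' \<gamma> (rho l0) (prs l0) ((q + 0 / 4)\<^sup>2) * (q / 2))
        + (- 1 / 2) * hugoniot_scale \<gamma> (rho l0) (prs l0) ((q + 0 / 4)\<^sup>2))
      + velocity_drop' \<gamma> (rho l0) (prs l0) ((q + 0 / 4)\<^sup>2) * (q / 2)) (at 0)"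
    by (intro DERIV_add DERIV_const DERIV_mult' D) (auto intro!: derivative_eq_intros)
  moreover have "(\<lambda>t. G (xs, t, 0, 0, 0) 0) =
      (\<lambda>t. u - w + (0 - t) / 2 * hugoniot_scale \<gamma> (rho l0) (prs l0) ((q + t / 4)\<^sup>2)
        + velocity_drop \<gamma> (rho l0) (prs l0) ((q + t / 4)\<^sup>2))"
    by (simp add: fun_eq_iff G_def defect_def Let_def perturbed_left_def left_state_def left(2) right(2)
      p_def[symmetric] q_def[symmetric])
  ultimately show ?thesis
    using q m by (simp add: scale_value drop'_value field_simps)
qed

section \<open>The shock boundary function and its derivatives\<close>

lemma Y2_a0: "Y2 a0 0 = 0"
  \<comment> \<open>A constant sequence turns the limit statement into the value at the
    background.\<close>
  using Y2_tendsto[of "\<lambda>_::nat. a0" sequentially "\<lambda>_. 0"] by (simp add: tendsto_const_iff)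

lemma \<sigma>_pos: "0 < \<sigma>"
  using \<gamma> \<gamma>3 w u by (simp add: \<sigma>_def add_pos_pos)

text \<open>The choice in \<open>shock_boundary\<close> is meaningful because
  \<open>(Y2 a (g a), g a)\<close> qualifies, with \<open>g\<close> the implicit root of
  \<open>G\<close>.\<close>

lemma is_shock_boundary: "is_shock_boundary \<gamma> xs Um Up (shock_boundary \<gamma> xs Um Up)"
proof -
  have "0 < G' a0 0" using q m M(1) \<sigma>_pos by (simp add: G'_a0)
  then obtain g where g: "g a0 = 0" "isCont g a0" "\<forall>\<^sub>F (a, y) in nhds (a0, 0). G a y = 0 \<longleftrightarrow> y = g a"
    using implicit_function_scalar[OF G_deriv G_cont G'_cont _ G_a0] by blast
  have glim: "(g \<longlongrightarrow> 0) (at a0)" using g by (simp add: isCont_def)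
  have "((\<lambda>a. Y2 a (g a)) \<longlongrightarrow> 0) (at a0)"
    by (rule Y2_tendsto[OF _ glim]) (auto intro!: tendsto_intros)
  then have "isCont (\<lambda>a. (Y2 a (g a), g a)) a0"
    using glim by (simp add: isCont_def g(1) Y2_a0 tendsto_Pair)
  moreover have "\<forall>\<^sub>F ((x, y1, r, v, h), (y2, y3)) in nhds (a0, (0, 0)).
      shock_relations \<gamma> (left_state (Um x) r v h) (right_state \<gamma> (Up x) y1 y2 y3) \<longleftrightarrow>
      (y2, y3) = (\<lambda>a. (Y2 a (g a), g a)) (x, y1, r, v, h)"
  proof -
    have "((\<lambda>z. (fst z, snd (snd z))) \<longlongrightarrow> (a0, 0)) (nhds (a0, (0 :: real, 0 :: real)))"
      by (auto intro!: tendsto_eq_intros filterlim_ident)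
    from eventually_compose_filterlim[OF g(3) this] shock_relations_eventually show ?thesis
      by eventually_elim auto
  qed
  ultimately have "\<exists>A. is_shock_boundary \<gamma> xs Um Up A"
    unfolding is_shock_boundary_def by blast
  then show ?thesis unfolding shock_boundary_def by (rule someI_ex)
qed

definition A where "A a = snd (shock_boundary \<gamma> xs Um Up a)"

text \<open>Extracted from the defining predicate alone, hence valid for whichever representative is
  chosen.\<close>

lemma shock_branch: "A a0 = 0" "isCont A a0" "\<forall>\<^sub>F a in nhds a0. G a (A a) = 0"
proof -
  let ?A = "shock_boundary \<gamma> xs Um Up"
  from is_shock_boundary have cont: "isCont ?A a0"
    and ev: "\<forall>\<^sub>F ((x, y1, r, v, h), (y2, y3)) in nhds (a0, (0, 0)).
      shock_relations \<gamma> (left_state (Um x) r v h) (right_state \<gamma> (Up x) y1 y2 y3) \<longleftrightarrow>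
      (y2, y3) = ?A (x, y1, r, v, h)"
    unfolding is_shock_boundary_def by auto
  from ev shock_relations_eventually have ev':
    "\<forall>\<^sub>F z in nhds (a0, (0, 0)). snd z = ?A (fst z) \<longleftrightarrow>
      fst (snd z) = Y2 (fst z) (snd (snd z)) \<and> G (fst z) (snd (snd z)) = 0"
  proof eventually_elim
    case (elim z)
    obtain x y1 r v h y2 y3 where "z = ((x, y1, r, v, h), (y2, y3))" by (metis surj_pair)
    then show ?case using elim by simp
  qed
  \<comment> \<open>The equivalence also holds at the point itself, where its right side is
    true.\<close>
  have A0: "?A a0 = (0, 0)"
    using eventually_nhds_x_imp_x[OF ev'] Y2_a0 G_a0 by simp
  then show "A a0 = 0" by (simp add: A_def)
  show "isCont A a0" unfolding A_def[abs_def] by (intro isCont_snd cont)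
  have "(?A \<longlongrightarrow> (0, 0)) (nhds a0)"
    using cont tendsto_at_iff_tendsto_nhds[of ?A a0] by (simp add: isCont_def A0)
  \<comment> \<open>On the graph of \<open>?A\<close> the left side of the equivalence is trivially
    true, which leaves \<open>G a (A a) = 0\<close>.\<close>
  then have "((\<lambda>a. (a, ?A a)) \<longlongrightarrow> (a0, (0, 0))) (nhds a0)"
    by (intro tendsto_intros filterlim_ident)
  from eventually_compose_filterlim[OF ev' this] show "\<forall>\<^sub>F a in nhds a0. G a (A a) = 0"
    by eventually_elim (auto simp: A_def)
qed

text \<open>Each partial derivative of \<open>A3\<close> is taken along its own curve through the
  background; the denominator is always \<open>G' a0 0\<close>.\<close>

lemma A_curve_deriv:
  assumes c: "isCont c t0" "c t0 = a0" and d: "((\<lambda>t. G (c t) 0) has_real_derivative e) (at t0)"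
  shows "deriv (\<lambda>t. A (c t)) t0 = - e / (q / (2 * m) * (M + \<sigma>))"
proof -
  have "((\<lambda>t. A (c t)) has_real_derivative - e / G' (c t0) 0) (at t0)"
  proof (rule implicit_function_scalar_deriv[where F = G and F' = G' and c = c and g = "\<lambda>t. A (c t)" and ?y0.0 = 0 and ?t0.0 = t0])
    show "isCont (\<lambda>t. A (c t)) t0" by (rule isCont_o2[OF c(1)]) (simp add: c(2) shock_branch(2))
    have "(c \<longlongrightarrow> a0) (nhds t0)"
      using c tendsto_at_iff_tendsto_nhds[of c t0] by (simp add: isCont_def)
    then show "\<forall>\<^sub>F t in nhds t0. G (c t) (A (c t)) = 0"
      by (rule eventually_compose_filterlim[OF shock_branch(3)])
  qed (use c d G_deriv G'_cont G_a0 shock_branch(1) q m M(1) \<sigma>_pos in \<open>auto simp: G'_a0\<close>)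
  then show ?thesis using c by (simp add: DERIV_imp_deriv G'_a0)
qed

lemma A3_deriv_x:
  "deriv (\<lambda>x. A3 \<gamma> xs Um Up x 0 0 0 0) xs =
    - (k * (w - u) * ((3 - \<gamma>) * w - (\<gamma> - 1) * u) / (4 * w)) / (q / (2 * m) * (M + \<sigma>))"
  unfolding A3_def A_def[symmetric]
  by (rule A_curve_deriv[OF _ _ G_curve_x]) (simp_all add: isCont_def tendsto_Pair)

lemma A3_deriv_y1:
  "deriv (\<lambda>y. A3 \<gamma> xs Um Up xs y 0 0 0) 0 = (M - \<sigma>) / (M + \<sigma>)"
proof -
  have "deriv (\<lambda>y. A3 \<gamma> xs Um Up xs y 0 0 0) 0 = - (q / (2 * m) * (\<sigma> - M)) / (q / (2 * m) * (M + \<sigma>))"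
    unfolding A3_def A_def[symmetric]
    by (rule A_curve_deriv[OF _ _ G_curve_y]) (simp_all add: isCont_def tendsto_Pair)
  also have "\<dots> = (M - \<sigma>) / (M + \<sigma>)" using q m by (simp add: minus_mult_right)
  finally show ?thesis .
qed

section \<open>Derivatives of the shock speed function\<close>

text \<open>The product of roots equals \<open>w\<close> at the background, so its derivative is
  \<open>w / 2\<close> times the logarithmic derivative of the radicand.\<close>

lemma wave_speed_deriv:
  fixes rl pl rr pr :: "real \<Rightarrow> real"
  assumes D: "(rl has_real_derivative rl') (at t)" "(pl has_real_derivative pl') (at t)"
    "(rr has_real_derivative rr') (at t)" "(pr has_real_derivative pr') (at t)"
    and v: "rl t = m / w" "rr t = m / u" "pr t - pl t = m * (w - u)"
  shows "((\<lambda>t. sqrt (rr t / rl t) * sqrt ((pr t - pl t) / (rr t - rl t))) has_real_derivative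
    w / 2 * (rr' * u / m - rl' * w / m + (pr' - pl') / (m * (w - u)) - (rr' - rl') * u * w / (m * (w - u)))) (at t)"
proof -
  have nz: "rl t \<noteq> 0" "rr t - rl t \<noteq> 0" using v m w u uw by (auto simp: field_simps)
  have rd: "rr t - rl t = m * (w - u) / (u * w)" using w u by (simp add: v field_simps)
  let ?D = "(rr' * rl t - rr t * rl') / (rl t * rl t) * ((pr t - pl t) / (rr t - rl t))
    + ((pr' - pl') * (rr t - rl t) - (pr t - pl t) * (rr' - rl')) / ((rr t - rl t) * (rr t - rl t)) * (rr t / rl t)"
  have I: "((\<lambda>t. rr t / rl t * ((pr t - pl t) / (rr t - rl t))) has_real_derivative ?D) (at t)"
    by (intro DERIV_mult DERIV_divide DERIV_diff D nz)
  have val: "rr t / rl t * ((pr t - pl t) / (rr t - rl t)) = w\<^sup>2"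
    unfolding rd unfolding v using m w u uw by (simp add: power2_eq_square)
  have "((\<lambda>t. sqrt (rr t / rl t * ((pr t - pl t) / (rr t - rl t)))) has_real_derivative inverse w / 2 * ?D) (at t)"
  proof -
    have "sqrt (w\<^sup>2) = w" using w by simp
    moreover have "0 < rr t / rl t * ((pr t - pl t) / (rr t - rl t))" unfolding val using w by simp
    ultimately show ?thesis
      using DERIV_real_sqrt[THEN DERIV_chain2, OF _ I] unfolding val by metis
  qed
  moreover have "inverse w / 2 * ?D =
    w / 2 * (rr' * u / m - rl' * w / m + (pr' - pl') / (m * (w - u)) - (rr' - rl') * u * w / (m * (w - u)))"
  proof -
    define e where "e = w - u"
    have e: "e \<noteq> 0" using uw by (simp add: e_def)
    have 1: "(rr' * (m / w) - m / u * rl') / (m / w * (m / w)) * (m * e / (m * e / (u * w)))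
        = w\<^sup>2 * (rr' * u / m - rl' * w / m)"
      using m w u e by (simp add: field_simps power2_eq_square)
    have 2: "(x * f - g * a) / (f * f) * r = x / f * r - a * (g / f / f * r)"
      if "f \<noteq> 0" for x f g a r :: real
      using that by (simp add: diff_divide_distrib left_diff_distrib right_diff_distrib mult_ac)
    have 3: "(pr' - pl') / (m * e / (u * w)) * (w / u) = w\<^sup>2 * ((pr' - pl') / (m * e))"
      "m * e / (m * e / (u * w)) / (m * e / (u * w)) * (w / u) = w\<^sup>2 * (u * w / (m * e))"
      using m w u e by (simp_all add: field_simps power2_eq_square)
    have 4: "m / u / (m / w) = w / u" and 5: "m * e / (u * w) \<noteq> 0"
      using m w u e by auto
    have "?D = w\<^sup>2 * (rr' * u / m - rl' * w / m) + (w\<^sup>2 * ((pr' - pl') / (m * e)) - (rr' - rl') * (w\<^sup>2 * (u * w / (m * e))))"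
      unfolding rd unfolding v e_def[symmetric] 1 4 2[OF 5] 3 ..
    also have "\<dots> = w\<^sup>2 * (rr' * u / m - rl' * w / m + (pr' - pl') / (m * e) - (rr' - rl') * u * w / (m * e))"
      by (simp add: algebra_simps)
    finally show ?thesis unfolding e_def[symmetric] using w by (simp add: power2_eq_square)
  qed
  ultimately show ?thesis by (simp only: real_sqrt_mult)
qed

lemma right_state_Up:
  assumes "0 < sqrt (prs b) + (y1 + y3) / 4" "0 < rho b" "0 < prs b"
  shows "rho (right_state \<gamma> b y1 0 y3) = rho b * ((sqrt (prs b) + (y1 + y3) / 4)\<^sup>2 / prs b) powr (1 / \<gamma>)"
    "prs (right_state \<gamma> b y1 0 y3) = (sqrt (prs b) + (y1 + y3) / 4)\<^sup>2"
  using right_state_eq[of \<gamma> b y1 y3 0] assms \<gamma> by simp_all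

text \<open>The value is nonzero because \<open>k\<close> and \<open>w\<close> are positive, which
  justifies the quotient in \<open>theta_d\<close>.\<close>

lemma shock_speed_deriv_x:
  "deriv (\<lambda>x. shock_speed \<gamma> Um Up x 0 0 0 0 0 0) xs = - (k * w / 2)"
proof -
  note D = background_deriv
  have "((\<lambda>x. vel (Um x) - sqrt (rho (Up x) / rho (Um x)) *
      sqrt ((prs (Up x) - prs (Um x)) / (rho (Up x) - rho (Um x)))) has_real_derivative
    \<kappa> * C * w - w / 2 * (2 * \<kappa> * m * u / m - (- 2 * \<kappa> * m) * w / m
      + (\<kappa> * m * B * u - - (\<kappa> * m * C * w)) / (m * (w - u))
      - (2 * \<kappa> * m - (- 2 * \<kappa> * m)) * u * w / (m * (w - u)))) (at xs)"
    by (intro DERIV_diff wave_speed_deriv D) (use left right prs_diff in \<open>auto simp: p_def\<close>)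
  moreover have "\<kappa> * C * w - w / 2 * (2 * \<kappa> * m * u / m - (- 2 * \<kappa> * m) * w / m
      + (\<kappa> * m * B * u - - (\<kappa> * m * C * w)) / (m * (w - u))
      - (2 * \<kappa> * m - (- 2 * \<kappa> * m)) * u * w / (m * (w - u))) = - ((\<kappa> * d) * w / 2)"
  proof -
    have "(\<kappa> * m * B * u - - (\<kappa> * m * C * w)) / (m * (w - u)) - (2 * \<kappa> * m - (- 2 * \<kappa> * m)) * u * w / (m * (w - u))
      = \<kappa> * (B * u + C * w - 4 * u * w) / (w - u)"
    proof -
      have "(\<kappa> * m * b * u - - (\<kappa> * m * c * w)) / (m * e) - (2 * \<kappa> * m - (- 2 * \<kappa> * m)) * u * w / (m * e)
        = \<kappa> * (b * u + c * w - 4 * u * w) / e" if "e \<noteq> 0" for b c e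
        using m that by (simp add: field_simps)
      then show ?thesis using uw by simp
    qed
    \<comment> \<open>A multiple of the square of \<open>w - u\<close>, so one factor survives the
      division.\<close>
    also have "B * u + C * w - 4 * u * w = - ((\<gamma> - 1) * (w - u)) * (w - u)"
      by (simp add: B_def algebra_simps)
    also have "\<kappa> * (- ((\<gamma> - 1) * (w - u)) * (w - u)) / (w - u) = - (\<kappa> * (\<gamma> - 1) * (w - u))"
      using uw by simp
    finally have 1: "(\<kappa> * m * B * u - - (\<kappa> * m * C * w)) / (m * (w - u)) - (2 * \<kappa> * m - (- 2 * \<kappa> * m)) * u * w / (m * (w - u))
      = - (\<kappa> * (\<gamma> - 1) * (w - u))" .
    have 2: "2 * \<kappa> * m * u / m - (- 2 * \<kappa> * m) * w / m = 2 * \<kappa> * (u + w)"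
      using m by (simp add: field_simps)
    have 3: "a + b - c = a + (b - c)" for a b c :: real by simp
    show ?thesis unfolding 3 1 2 by (simp add: field_simps)
  qed
  moreover have "\<forall>\<^sub>F x in nhds xs. vel (Um x) - sqrt (rho (Up x) / rho (Um x)) *
      sqrt ((prs (Up x) - prs (Um x)) / (rho (Up x) - rho (Um x))) = shock_speed \<gamma> Um Up x 0 0 0 0 0 0"
  proof -
    have lim: "((\<lambda>x. (x, 0, 0, 0, 0)) \<longlongrightarrow> a0) (nhds xs)"
      by (auto intro!: tendsto_intros filterlim_ident)
    note order_tendstoD(1)[OF background_tendsto(6)[OF lim] p(2)]
      order_tendstoD(1)[OF background_tendsto(4)[OF lim] rho_right]
    then show ?thesis
      by eventually_elim (simp add: shock_speed_def Let_def left_state_def right_state_Up)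
  qed
  ultimately show ?thesis
    by (intro DERIV_imp_deriv) (simp add: DERIV_cong_ev k_eq[symmetric])
qed

text \<open>The shock speed sees the right state only through density and pressure, which depend on
  \<open>y1 + y3\<close>; hence the two derivatives coincide.\<close>

lemma shock_speed_deriv_y:
  "deriv (\<lambda>y. shock_speed \<gamma> Um Up xs y 0 0 0 0 0) 0 = - (q * w * (\<gamma> + 1) / (4 * m * B))"
  "deriv (\<lambda>y. shock_speed \<gamma> Um Up xs 0 0 y 0 0 0) 0 = - (q * w * (\<gamma> + 1) / (4 * m * B))"
proof -
  define P where "P y = (q + y / 4)\<^sup>2" for y
  define R where "R y = rho (Up xs) * (P y / p) powr (1 / \<gamma>)" for y
  have P0: "P 0 = p" using q by (simp add: P_def)
  have DP: "(P has_real_derivative q / 2) (at 0)"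
    unfolding P_def[abs_def] by (auto intro!: derivative_eq_intros)
  have "((\<lambda>y. P y / p) has_real_derivative q / 2 / p) (at 0)"
    by (rule DERIV_cdivide[OF DP])
  from DERIV_fun_powr[OF this, of "1 / \<gamma>"]
  have "((\<lambda>y. (P y / p) powr (1 / \<gamma>)) has_real_derivative 1 / \<gamma> * (q / 2 / p)) (at 0)"
    using p(2) by (simp add: P0)
  from DERIV_cmult[OF this, of "rho (Up xs)"]
  have "(R has_real_derivative rho (Up xs) * (1 / \<gamma> * (q / 2 / p))) (at 0)"
    unfolding R_def[abs_def] .
  moreover have "rho (Up xs) * (1 / \<gamma> * (q / 2 / p)) = q / (u * B)"
    using m \<gamma> by (simp add: p(1) right(1))
  ultimately have DR: "(R has_real_derivative q / (u * B)) (at 0)" by simp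
  have "((\<lambda>y. w - sqrt (R y / rho l0) * sqrt ((P y - prs l0) / (R y - rho l0))) has_real_derivative
    0 - w / 2 * (q / (u * B) * u / m - 0 * w / m + (q / 2 - 0) / (m * (w - u)) - (q / (u * B) - 0) * u * w / (m * (w - u)))) (at 0)"
    by (intro DERIV_diff wave_speed_deriv DERIV_const DP DR)
      (use left(1) right(1) prs_diff p in \<open>auto simp: P0 R_def\<close>)
  moreover have "0 - w / 2 * (q / (u * B) * u / m - 0 * w / m + (q / 2 - 0) / (m * (w - u)) - (q / (u * B) - 0) * u * w / (m * (w - u)))
    = - (q * w * (\<gamma> + 1) / (4 * m * B))"
  proof -
    define e where "e = w - u"
    have e: "0 < e" "w = u + e" "B = (\<gamma> + 1) * e + 2 * u" using uw by (auto simp: e_def B_def algebra_simps)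
    have "0 - w / 2 * (q / (u * B) * u / m - 0 * w / m + (q / 2 - 0) / (m * e) - (q / (u * B) - 0) * u * w / (m * e))
      = - (w * q * (2 * e + B - 2 * w) / (4 * m * B * e))"
      using u m e(1) B_pos by (simp add: field_simps)
    also have "2 * e + B - 2 * w = (\<gamma> + 1) * e" using e by simp
    finally show ?thesis using e(1) unfolding e_def[symmetric] by (simp add: mult_ac)
  qed
  ultimately have D: "((\<lambda>y. w - sqrt (R y / rho l0) * sqrt ((P y - prs l0) / (R y - rho l0)))
    has_real_derivative - (q * w * (\<gamma> + 1) / (4 * m * B))) (at 0)" by (rule DERIV_cong)
  have "((\<lambda>y. q + y / 4) \<longlongrightarrow> q) (nhds 0)" by (auto intro!: tendsto_eq_intros filterlim_ident)
  from order_tendstoD(1)[OF this q(1)]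
  have "\<forall>\<^sub>F y in nhds 0. w - sqrt (R y / rho l0) * sqrt ((P y - prs l0) / (R y - rho l0)) =
      shock_speed \<gamma> Um Up xs y 0 0 0 0 0"
    "\<forall>\<^sub>F y in nhds 0. w - sqrt (R y / rho l0) * sqrt ((P y - prs l0) / (R y - rho l0)) =
      shock_speed \<gamma> Um Up xs 0 0 y 0 0 0"
    by (eventually_elim, use rho_right p(2) in \<open>simp add: shock_speed_def Let_def left_state_def
      right_state_Up R_def P_def q_def p_def left(2)\<close>)+
  then show "deriv (\<lambda>y. shock_speed \<gamma> Um Up xs y 0 0 0 0 0) 0 = - (q * w * (\<gamma> + 1) / (4 * m * B))"
    "deriv (\<lambda>y. shock_speed \<gamma> Um Up xs 0 0 y 0 0 0) 0 = - (q * w * (\<gamma> + 1) / (4 * m * B))"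
    by (auto intro!: DERIV_imp_deriv DERIV_cong_ev[OF refl _ refl, THEN iffD1, OF _ D])
qed

text \<open>The area slope \<open>k\<close>, the mass flux \<open>m\<close> and the pressure root
  \<open>q\<close> all cancel, leaving a function of \<gamma>, \<open>w\<close> and
  \<open>u\<close>.\<close>

lemma theta_d_eq:
  "theta_d \<gamma> xs Um Up =
     (d * \<bar>(3 - \<gamma>) * w - (\<gamma> - 1) * u\<bar> / (2 * w * B) + \<bar>M - \<sigma>\<bar>) / (M + \<sigma>)"
proof -
  define s Z where "s = M + \<sigma>" and "Z = (3 - \<gamma>) * w - (\<gamma> - 1) * u"
  have s: "0 < s" using M(1) \<sigma>_pos by (simp add: s_def)
  have "\<bar>deriv (\<lambda>x. A3 \<gamma> xs Um Up x 0 0 0 0) xs\<bar> = k * (w - u) * \<bar>Z\<bar> / (4 * w) / (q / (2 * m) * s)"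
    using k uw w q m s by (simp add: A3_deriv_x s_def[symmetric] Z_def[symmetric] abs_mult)
  moreover have "\<bar>deriv (\<lambda>x. shock_speed \<gamma> Um Up x 0 0 0 0 0 0) xs\<bar> = k * w / 2"
    using k w by (simp add: shock_speed_deriv_x)
  moreover have "\<bar>deriv (\<lambda>y. shock_speed \<gamma> Um Up xs y 0 0 0 0 0) 0\<bar>
      + \<bar>deriv (\<lambda>y. shock_speed \<gamma> Um Up xs 0 0 y 0 0 0) 0\<bar> = q * w * (\<gamma> + 1) / (2 * m * B)"
    using q w \<gamma> m B_pos by (simp add: shock_speed_deriv_y mult_ac)
  moreover have "\<bar>deriv (\<lambda>y. A3 \<gamma> xs Um Up xs y 0 0 0) 0\<bar> = \<bar>M - \<sigma>\<bar> / s"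
    using s by (simp add: A3_deriv_y1 s_def[symmetric])
  moreover have "k * e * z / (4 * w) / (q / (2 * m) * s) * inverse (k * w / 2) * (q * w * g / (2 * m * B)) + r / s
      = (g * e * z / (2 * w * B) + r) / s" for e z g r
    using k w q m s B_pos by (simp add: field_simps)
  ultimately show ?thesis unfolding theta_d_def s_def[symmetric] Z_def[symmetric] by (simp only:)
qed

lemma dissipative_of_mach:
  assumes "1 < M\<^sup>2 + 2 * M"
  shows "dissipative_shock_boundary \<gamma> xs Um Up"
proof -
  define Z where "Z = (3 - \<gamma>) * w - (\<gamma> - 1) * u"
  have d: "0 < d" "d = B - 2 * u" using \<gamma> uw by (simp, simp add: B_def algebra_simps)
  have a: "0 < (3 - \<gamma>) * w" "(3 - \<gamma>) * w \<le> 2 * w" and b: "0 < (\<gamma> - 1) * u" "(\<gamma> - 1) * u \<le> 2 * u"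
    "(\<gamma> - 1) * u < (\<gamma> + 1) * u"
    using \<gamma> \<gamma>3 u w by (auto intro!: mult_right_mono mult_strict_right_mono)
  \<comment> \<open>\<open>Z\<close> is a difference of two numbers between 0 and
    \<open>2 * w\<close>.\<close>
  have "\<bar>Z\<bar> \<le> 2 * w" using a b uw unfolding Z_def by linarith
  then have "d * \<bar>Z\<bar> / (2 * w * B) \<le> d * (2 * w) / (2 * w * B)"
    using d(1) w B_pos by (intro divide_right_mono mult_left_mono) auto
  also have "\<dots> = 1 - M\<^sup>2" using w B_pos unfolding d(2) by (simp add: M(2) diff_divide_distrib)
  also have "\<dots> < 2 * M" using assms by simp
  finally have X1: "d * \<bar>Z\<bar> / (2 * w * B) < 2 * M" .
  \<comment> \<open>For the comparison with \<open>2 * \<sigma>\<close> the cruder bound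
    \<open>d < B\<close> suffices.\<close>
  have "d * \<bar>Z\<bar> / (2 * w * B) \<le> B * \<bar>Z\<bar> / (2 * w * B)"
    using d u w B_pos by (intro divide_right_mono mult_right_mono) auto
  also have "\<dots> = \<bar>Z\<bar> / (2 * w)" using B_pos by simp
  also have "\<dots> < (4 * w * \<sigma>) / (2 * w)"
  proof -
    have "\<bar>Z\<bar> < (3 - \<gamma>) * w + (\<gamma> + 1) * u" using a b unfolding Z_def by linarith
    also have "\<dots> = 4 * w * \<sigma>" using w by (simp add: \<sigma>_def)
    finally show ?thesis using w by (intro divide_strict_right_mono) auto
  qed
  also have "\<dots> = 2 * \<sigma>" using w by simp
  finally have X2: "d * \<bar>Z\<bar> / (2 * w * B) < 2 * \<sigma>" .
  have "d * \<bar>Z\<bar> / (2 * w * B) + \<bar>M - \<sigma>\<bar> < M + \<sigma>" using X1 X2 by linarith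
  then have "theta_d \<gamma> xs Um Up < 1"
    unfolding theta_d_eq Z_def using M(1) \<sigma>_pos by (subst divide_less_eq_1_pos) auto
  then show ?thesis
    using k w by (simp add: dissipative_shock_boundary_def shock_speed_deriv_x)
qed

text \<open>This is positivity of the upstream pressure.\<close>

lemma mach_lower_bound: "(\<gamma> - 1) / (2 * \<gamma>) < M\<^sup>2"
proof -
  have "(\<gamma> - 1) * B < 4 * \<gamma> * u"
  proof -
    have "(\<gamma> + 1) * ((\<gamma> - 1) * w) < (\<gamma> + 1) * ((\<gamma> + 1) * u)"
      using C \<gamma> by (intro mult_strict_left_mono) auto
    then show ?thesis by (simp add: B_def algebra_simps)
  qed
  then show ?thesis using \<gamma> B_pos by (simp add: M(2) field_simps)
qed

end

theorem lemma3p2: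
  shows "\<exists>\<gamma>c::real. 1 < \<gamma>c \<and> \<gamma>c < 5 / 3 \<and>
    (\<forall>\<gamma>. \<gamma>c < \<gamma> \<and> \<gamma> < 3 \<longrightarrow>
       (\<forall>L a xs Um Up. steady_transonic_shock \<gamma> L a xs Um Up \<longrightarrow>
          dissipative_shock_boundary \<gamma> xs Um Up)) \<and>
    (\<forall>\<gamma>. 1 < \<gamma> \<and> \<gamma> \<le> \<gamma>c \<longrightarrow>
       (\<exists>Mc<1. \<forall>L a xs Um Up. steady_transonic_shock \<gamma> L a xs Um Up \<longrightarrow>
          Mc < mach \<gamma> (Up xs) \<and> mach \<gamma> (Up xs) < 1 \<longrightarrow>
          dissipative_shock_boundary \<gamma> xs Um Up))"
\<comment> \<open>A rational between \<open>1 / (4 * sqrt 2 - 5)\<close>, about 1.52, where the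
  lower bound of \<open>mach_lower_bound\<close> reaches \<open>(sqrt 2 - 1)\<^sup>2\<close>, and
  \<open>5 / 3\<close>.\<close>
proof (rule exI[of _ "8 / 5 :: real"], intro conjI allI impI)
  fix \<gamma> L xs :: real and a Um Up
  assume g: "8 / 5 < \<gamma> \<and> \<gamma> < 3" and "steady_transonic_shock \<gamma> L a xs Um Up"
  then obtain m w u k where "transonic_background \<gamma> xs Um Up m w u k"
    using steady_transonic_shock_background[of \<gamma> L a xs Um Up] by force
  then interpret transonic_background \<gamma> xs Um Up m w u k .
  have "3 / 16 < (\<gamma> - 1) / (2 * \<gamma>)" using g by (simp add: field_simps)
  from this mach_lower_bound have "3 / 16 < M\<^sup>2" by (rule less_trans)
  \<comment> \<open>Chosen so that \<open>3 / 16 + 2 * (13 / 32) = 1\<close>; its square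
    \<open>169 / 1024\<close> is still below \<open>3 / 16\<close>.\<close>
  moreover have "13 / 32 < M"
  proof (rule power2_less_imp_less)
    show "(13 / 32)\<^sup>2 < M\<^sup>2" using calculation by (simp add: power2_eq_square)
  qed (use M(1) in simp)
  ultimately show "dissipative_shock_boundary \<gamma> xs Um Up"
    by (intro dissipative_of_mach) simp
next
  fix \<gamma> :: real assume g: "1 < \<gamma> \<and> \<gamma> \<le> 8 / 5"
  show "\<exists>Mc<1. \<forall>L a xs Um Up. steady_transonic_shock \<gamma> L a xs Um Up \<longrightarrow>
          Mc < mach \<gamma> (Up xs) \<and> mach \<gamma> (Up xs) < 1 \<longrightarrow> dissipative_shock_boundary \<gamma> xs Um Up"
  \<comment> \<open>Above one half, \<open>2 * M\<close> alone exceeds 1, whatever \<gamma>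
    is.\<close>
  proof (intro exI[of _ "1 / 2 :: real"] conjI allI impI)
    fix L xs a Um Up
    assume "steady_transonic_shock \<gamma> L a xs Um Up" and Mr: "1 / 2 < mach \<gamma> (Up xs) \<and> mach \<gamma> (Up xs) < 1"
    then obtain m w u k where "transonic_background \<gamma> xs Um Up m w u k"
      using steady_transonic_shock_background[of \<gamma> L a xs Um Up] g by force
    then interpret transonic_background \<gamma> xs Um Up m w u k .
    have "1 / 2 < M" using Mr mach_eq by simp
    moreover have "0 < M\<^sup>2" using M(1) by (rule zero_less_power)
    ultimately show "dissipative_shock_boundary \<gamma> xs Um Up"
      by (intro dissipative_of_mach) linarith
  qed simp
qed simp_all

end
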